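(* Let $(\mathfrak{g},J)$ be a Lie algebra with complex structure. Then there is a complete deformation of $(\mathfrak{g},J)$.
   Context: A Lie algebra with complex structure $(\mathfrak{g},J)$ is a finite-dimensional real Lie algebra $\mathfrak{g}$ of even dimension $2n$ with an $\mathbb{R}$-linear map $J:\mathfrak{g}\to\mathfrak{g}$ such that $J^2=-1$ and $[JX,JY]-[X,Y]-J[JX,Y]-J[X,JY]=0$ for all $X,Y\in\mathfrak{g}$. Let $\mathfrak{g}_{\mathbb{C}}=\mathfrak{g}\otimes_{\mathbb{R}}\mathbb{C}=\mathfrak{g}^{1,0}\oplus\mathfrak{g}^{0,1}$ be the decomposition into the $\pm\sqrt{-1}$-eigenspaces of $J$, and put $\Lambda^{p,q}=\wedge^p\mathfrak{g}^{1,0*}\otimes\wedge^q\mathfrak{g}^{0,1*}\subset\wedge^{p+q}\mathfrak{g}_{\mathbb{C}}^*$. The Chevalley-Eilenberg differential $d$ (the antiderivation with $d\omega(x,y)=-\omega([x,y])$ for $\omega\in\mathfrak{g}_{\mathbb{C}}^*$) splits as $d=\partial+\bar\partial$ into parts of bidegree $(1,0)$ and $(0,1)$. The operator $\bar\partial:\Lambda^{0,q}\otimes\mathfrak{g}^{1,0}\to\Lambda^{0,q+1}\otimes\mathfrak{g}^{1,0}$ is defined by $(\bar\partial Y)(\bar X)=\mathrm{pr}^{1,0}[\bar X,Y]$ for $Y\in\mathfrak{g}^{1,0}$, $\bar X\in\mathfrak{g}^{0,1}$, and $\bar\partial(\eta\otimes Y)=\bar\partial\eta\otimes Y+(-1)^q\eta\wedge\bar\partial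 Y$ for $\eta\in\Lambda^{0,q}$. The Fröhlicher-Nijenhuis bracket $[\cdot,\cdot]:(\Lambda^{0,1}\otimes\mathfrak{g}^{1,0})\times(\Lambda^{0,1}\otimes\mathfrak{g}^{1,0})\to\Lambda^{0,2}\otimes\mathfrak{g}^{1,0}$ is the bilinear map with $$[\varphi\otimes X,\psi\otimes Y]=\varphi\wedge\psi\otimes[X,Y]-\big(i_Yd\varphi\wedge\psi\otimes X+i_Xd\psi\wedge\varphi\otimes Y+(i_Y\varphi)\,d\psi\otimes X+(i_X\psi)\,d\varphi\otimes Y\big).$$ Let $B$ be an analytic subset of the unit polydisc $\Delta^m\subseteq\mathbb{C}^m$ with $0\in B$. A holomorphic deformation of $(\mathfrak{g},J)$ over $B$ is a family $\phi(t)\in\Lambda^{0,1}\otimes\mathfrak{g}^{1,0}$ ($t\in B$), holomorphic in $t$, with $\phi(0)=0$ and $\bar\partial\phi(t)=\frac12[\phi(t),\phi(t)]$ for all $t\in B$. For $t$ small, $\phi(t)$ determines a complex structure $J_{\phi(t)}$ on $\mathfrak{g}$ whose $-\sqrt{-1}$-eigenspace is $(1-\phi(t))\mathfrak{g}^{0,1}$ and whose $\sqrt{-1}$-eigenspace is $(1-\overline{\phi(t)})\mathfrak{g}^{1,0}$. Two holomorphic deformations $\{\phi(t)\}_{t\in B}$, $\{\tilde\phi(t)\}_{t\in B}$ are equivalent if there are Lie algebra isomorphisms $f_t:\mathfrak{g}\to\mathfrak{g}$ with $J_{\tilde\phi(t)}=f_t^{-1}J_{\phi(t)}f_t$ and $f_t$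 holomorphic in $t$ (i.e. for every $x\in\mathfrak{g}_{\mathbb{C}}$ the map $t\mapsto f_t(x)\in\mathfrak{g}_{\mathbb{C}}$ is holomorphic on $B$). A small deformation is a germ at $0$ of a holomorphic deformation. For a germ of a holomorphic map $h:(D,0)\to(B,0)$, where $D$ is an analytic subset of the unit polydisc $\Delta^l\subseteq\mathbb{C}^l$ with $0\in D$, the pull back of $\{\phi(t)\}_{t\in B}$ by $h$ is the small deformation $\{\phi(h(s))\}_{s\in D}$. A small deformation $\{\phi(t)\}_{t\in B}$ is complete if for every small deformation $\{\psi(s)\}_{s\in D}$ of $(\mathfrak{g},J)$ there is a holomorphic map $h:(D,0)\to(B,0)$ such that $\{\psi(s)\}_{s\in D}$ is equivalent to the pull back of $\{\phi(t)\}_{t\in B}$ by $h$. *)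

theory Defs
  imports "HOL-Analysis.Analysis"
begin

section \<open>Complexification of a real vector space\<close>

text \<open>An element \<open>(x, y)\<close> of \<open>'g \<times> 'g\<close> stands for \<open>x + \<i> y\<close> in the complexification of \<open>'g\<close>.\<close>

type_synonym 'g cplx = "'g \<times> 'g"

definition cscale :: "complex \<Rightarrow> 'g::real_vector cplx \<Rightarrow> 'g cplx" where
  "cscale c z = (Re c *\<^sub>R fst z - Im c *\<^sub>R snd z, Re c *\<^sub>R snd z + Im c *\<^sub>R fst z)"

definition conj_cplx :: "'g::real_vector cplx \<Rightarrow> 'g cplx" where
  "conj_cplx z = (fst z, - snd z)"

definition cmap :: "('g \<Rightarrow> 'g) \<Rightarrow> 'g cplx \<Rightarrow> 'g cplx" where
  "cmap f z = (f (fst z), f (snd z))"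

definition cbr :: "('g::real_vector \<Rightarrow> 'g \<Rightarrow> 'g) \<Rightarrow> 'g cplx \<Rightarrow> 'g cplx \<Rightarrow> 'g cplx" where
  "cbr br z w = (br (fst z) (fst w) - br (snd z) (snd w), br (fst z) (snd w) + br (snd z) (fst w))"

lemma vector_space_cscale: "vector_space (cscale :: complex \<Rightarrow> 'g::real_vector cplx \<Rightarrow> 'g cplx)"
  by unfold_locales (auto simp: cscale_def algebra_simps)

section \<open>Lie algebras with complex structure\<close>

definition lie_algebra :: "('g::real_vector \<Rightarrow> 'g \<Rightarrow> 'g) \<Rightarrow> bool" where
  "lie_algebra br \<longleftrightarrow>
     bilinear br \<and> (\<forall>x. br x x = 0) \<and>
     (\<forall>x y z. br x (br y z) + br y (br z x) + br z (br x y) = 0)"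

definition complex_structure :: "('g::real_vector \<Rightarrow> 'g \<Rightarrow> 'g) \<Rightarrow> ('g \<Rightarrow> 'g) \<Rightarrow> bool" where
  "complex_structure br J \<longleftrightarrow>
     linear J \<and> (\<forall>x. J (J x) = - x) \<and>
     (\<forall>x y. br (J x) (J y) - br x y - J (br (J x) y) - J (br x (J y)) = 0)"

definition lie_algebra_with_cs :: "('g::real_vector \<Rightarrow> 'g \<Rightarrow> 'g) \<Rightarrow> ('g \<Rightarrow> 'g) \<Rightarrow> bool" where
  "lie_algebra_with_cs br J \<longleftrightarrow>
     (\<exists>S::'g set. finite S \<and> span S = UNIV) \<and> even (dim (UNIV :: 'g set)) \<and>
     lie_algebra br \<and> complex_structure br J"

definition g10 :: "('g::real_vector \<Rightarrow> 'g) \<Rightarrow> 'g cplx set" where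
  "g10 J = {z. cmap J z = cscale \<i> z}"

definition g01 :: "('g::real_vector \<Rightarrow> 'g) \<Rightarrow> 'g cplx set" where
  "g01 J = {z. cmap J z = cscale (- \<i>) z}"

definition pr10 :: "('g::real_vector \<Rightarrow> 'g) \<Rightarrow> 'g cplx \<Rightarrow> 'g cplx" where
  "pr10 J z = cscale (1/2) (z - cscale \<i> (cmap J z))"

definition pr01 :: "('g::real_vector \<Rightarrow> 'g) \<Rightarrow> 'g cplx \<Rightarrow> 'g cplx" where
  "pr01 J z = cscale (1/2) (z + cscale \<i> (cmap J z))"

section \<open>Forms and vector-valued forms\<close>

text \<open>
  An element of \<open>\<Lambda>\<^sup>0\<^sup>,\<^sup>q \<otimes> g\<^sup>1\<^sup>,\<^sup>0\<close> is the corresponding alternating \<open>q\<close>-linear map on the complexification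
  that vanishes as soon as one argument lies in \<open>g\<^sup>1\<^sup>,\<^sup>0\<close> and takes values in \<open>g\<^sup>1\<^sup>,\<^sup>0\<close>. The pure tensor
  \<open>\<eta> \<otimes> Y\<close> is \<open>tensor1 \<eta> Y\<close> for \<open>q = 1\<close> and \<open>tensor2 \<eta> Y\<close> for \<open>q = 2\<close>.
\<close>

abbreviation clinear_form :: "('g::real_vector cplx \<Rightarrow> complex) \<Rightarrow> bool" where
  "clinear_form \<equiv> Vector_Spaces.linear cscale (*)"

abbreviation clinear_map :: "('g::real_vector cplx \<Rightarrow> 'g cplx) \<Rightarrow> bool" where
  "clinear_map \<equiv> Vector_Spaces.linear cscale cscale"

definition Lam01 :: "('g::real_vector \<Rightarrow> 'g) \<Rightarrow> ('g cplx \<Rightarrow> complex) set" where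
  "Lam01 J = {\<eta>. clinear_form \<eta> \<and> (\<forall>x\<in>g10 J. \<eta> x = 0)}"

definition Lam01_g10 :: "('g::real_vector \<Rightarrow> 'g) \<Rightarrow> ('g cplx \<Rightarrow> 'g cplx) set" where
  "Lam01_g10 J = {\<Phi>. clinear_map \<Phi> \<and> (\<forall>x\<in>g10 J. \<Phi> x = 0) \<and> (\<forall>x. \<Phi> x \<in> g10 J)}"

definition Lam02_g10 :: "('g::real_vector \<Rightarrow> 'g) \<Rightarrow> ('g cplx \<Rightarrow> 'g cplx \<Rightarrow> 'g cplx) set" where
  "Lam02_g10 J = {\<Omega>. (\<forall>x. clinear_map (\<Omega> x)) \<and> (\<forall>y. clinear_map (\<lambda>x. \<Omega> x y)) \<and> (\<forall>x. \<Omega> x x = 0) \<and>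
     (\<forall>x\<in>g10 J. \<forall>y. \<Omega> x y = 0) \<and> (\<forall>x y. \<Omega> x y \<in> g10 J)}"

definition tensor1 :: "('g::real_vector cplx \<Rightarrow> complex) \<Rightarrow> 'g cplx \<Rightarrow> 'g cplx \<Rightarrow> 'g cplx" where
  "tensor1 \<eta> Y = (\<lambda>x. cscale (\<eta> x) Y)"

definition tensor2 :: "('g::real_vector cplx \<Rightarrow> 'g cplx \<Rightarrow> complex) \<Rightarrow> 'g cplx \<Rightarrow> 'g cplx \<Rightarrow> 'g cplx \<Rightarrow> 'g cplx" where
  "tensor2 \<omega> Y = (\<lambda>x y. cscale (\<omega> x y) Y)"

definition wedge :: "('g::real_vector cplx \<Rightarrow> complex) \<Rightarrow> ('g cplx \<Rightarrow> complex) \<Rightarrow> 'g cplx \<Rightarrow> 'g cplx \<Rightarrow> complex" where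
  "wedge \<eta> \<theta> = (\<lambda>x y. \<eta> x * \<theta> y - \<eta> y * \<theta> x)"

definition wedge_vec :: "('g::real_vector cplx \<Rightarrow> complex) \<Rightarrow> ('g cplx \<Rightarrow> 'g cplx) \<Rightarrow> 'g cplx \<Rightarrow> 'g cplx \<Rightarrow> 'g cplx" where
  "wedge_vec \<eta> A = (\<lambda>x y. cscale (\<eta> x) (A y) - cscale (\<eta> y) (A x))"

definition ce_d :: "('g::real_vector \<Rightarrow> 'g \<Rightarrow> 'g) \<Rightarrow> ('g cplx \<Rightarrow> complex) \<Rightarrow> 'g cplx \<Rightarrow> 'g cplx \<Rightarrow> complex" where
  "ce_d br \<eta> = (\<lambda>x y. - \<eta> (cbr br x y))"

definition contract :: "'g::real_vector cplx \<Rightarrow> ('g cplx \<Rightarrow> 'g cplx \<Rightarrow> complex) \<Rightarrow> 'g cplx \<Rightarrow> complex" where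
  "contract X \<omega> = \<omega> X"

text \<open>For \<open>\<eta> \<in> \<Lambda>\<^sup>0\<^sup>,\<^sup>1\<close>, the form \<open>dbar \<eta>\<close> is the component of bidegree \<open>(0, 2)\<close> of \<open>d \<eta>\<close>.\<close>

definition dbar_form :: "('g::real_vector \<Rightarrow> 'g \<Rightarrow> 'g) \<Rightarrow> ('g \<Rightarrow> 'g) \<Rightarrow> ('g cplx \<Rightarrow> complex) \<Rightarrow> 'g cplx \<Rightarrow> 'g cplx \<Rightarrow> complex" where
  "dbar_form br J \<eta> = (\<lambda>x y. ce_d br \<eta> (pr01 J x) (pr01 J y))"

definition dbar_vec :: "('g::real_vector \<Rightarrow> 'g \<Rightarrow> 'g) \<Rightarrow> ('g \<Rightarrow> 'g) \<Rightarrow> 'g cplx \<Rightarrow> 'g cplx \<Rightarrow> 'g cplx" where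
  "dbar_vec br J Y = (\<lambda>x. pr10 J (cbr br (pr01 J x) Y))"

text \<open>
  The operator \<open>dbar\<close> on \<open>\<Lambda>\<^sup>0\<^sup>,\<^sup>1 \<otimes> g\<^sup>1\<^sup>,\<^sup>0\<close> and the Froelicher-Nijenhuis bracket are the complex linear
  resp. bilinear maps with prescribed values on pure tensors. The lemmas \<open>is_dbar_dbar\<close>, \<open>is_dbar_apply\<close>,
  \<open>is_fn_bracket_fn_bracket\<close> and \<open>is_fn_bracket_apply\<close> below show that they exist and that their
  values on \<open>\<Lambda>\<^sup>0\<^sup>,\<^sup>1 \<otimes> g\<^sup>1\<^sup>,\<^sup>0\<close> are uniquely determined.
\<close>

definition is_dbar :: "('g::real_vector \<Rightarrow> 'g \<Rightarrow> 'g) \<Rightarrow> ('g \<Rightarrow> 'g) \<Rightarrow>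
    (('g cplx \<Rightarrow> 'g cplx) \<Rightarrow> 'g cplx \<Rightarrow> 'g cplx \<Rightarrow> 'g cplx) \<Rightarrow> bool" where
  "is_dbar br J D \<longleftrightarrow>
     (\<forall>\<Phi>\<in>Lam01_g10 J. D \<Phi> \<in> Lam02_g10 J) \<and>
     (\<forall>\<Phi>\<in>Lam01_g10 J. \<forall>\<Psi>\<in>Lam01_g10 J. D (\<lambda>x. \<Phi> x + \<Psi> x) = (\<lambda>x y. D \<Phi> x y + D \<Psi> x y)) \<and>
     (\<forall>c. \<forall>\<Phi>\<in>Lam01_g10 J. D (\<lambda>x. cscale c (\<Phi> x)) = (\<lambda>x y. cscale c (D \<Phi> x y))) \<and>
     (\<forall>\<eta>\<in>Lam01 J. \<forall>Y\<in>g10 J.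
        D (tensor1 \<eta> Y) = (\<lambda>x y. tensor2 (dbar_form br J \<eta>) Y x y - wedge_vec \<eta> (dbar_vec br J Y) x y))"

definition dbar :: "('g::real_vector \<Rightarrow> 'g \<Rightarrow> 'g) \<Rightarrow> ('g \<Rightarrow> 'g) \<Rightarrow>
    ('g cplx \<Rightarrow> 'g cplx) \<Rightarrow> 'g cplx \<Rightarrow> 'g cplx \<Rightarrow> 'g cplx" where
  "dbar br J = (SOME D. is_dbar br J D)"

definition is_fn_bracket :: "('g::real_vector \<Rightarrow> 'g \<Rightarrow> 'g) \<Rightarrow> ('g \<Rightarrow> 'g) \<Rightarrow>
    (('g cplx \<Rightarrow> 'g cplx) \<Rightarrow> ('g cplx \<Rightarrow> 'g cplx) \<Rightarrow> 'g cplx \<Rightarrow> 'g cplx \<Rightarrow> 'g cplx) \<Rightarrow> bool" where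
  "is_fn_bracket br J F \<longleftrightarrow>
     (\<forall>\<Phi>\<in>Lam01_g10 J. \<forall>\<Psi>\<in>Lam01_g10 J. F \<Phi> \<Psi> \<in> Lam02_g10 J) \<and>
     (\<forall>\<Phi>\<in>Lam01_g10 J. \<forall>\<Phi>'\<in>Lam01_g10 J. \<forall>\<Psi>\<in>Lam01_g10 J.
        F (\<lambda>x. \<Phi> x + \<Phi>' x) \<Psi> = (\<lambda>x y. F \<Phi> \<Psi> x y + F \<Phi>' \<Psi> x y) \<and>
        F \<Psi> (\<lambda>x. \<Phi> x + \<Phi>' x) = (\<lambda>x y. F \<Psi> \<Phi> x y + F \<Psi> \<Phi>' x y)) \<and>
     (\<forall>c. \<forall>\<Phi>\<in>Lam01_g10 J. \<forall>\<Psi>\<in>Lam01_g10 J.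
        F (\<lambda>x. cscale c (\<Phi> x)) \<Psi> = (\<lambda>x y. cscale c (F \<Phi> \<Psi> x y)) \<and>
        F \<Psi> (\<lambda>x. cscale c (\<Phi> x)) = (\<lambda>x y. cscale c (F \<Psi> \<Phi> x y))) \<and>
     (\<forall>\<phi>\<in>Lam01 J. \<forall>X\<in>g10 J. \<forall>\<psi>\<in>Lam01 J. \<forall>Y\<in>g10 J.
        F (tensor1 \<phi> X) (tensor1 \<psi> Y) = (\<lambda>x y.
          tensor2 (wedge \<phi> \<psi>) (cbr br X Y) x y
          - (tensor2 (wedge (contract Y (ce_d br \<phi>)) \<psi>) X x y
             + tensor2 (wedge (contract X (ce_d br \<psi>)) \<phi>) Y x y
             + cscale (\<phi> Y) (tensor2 (ce_d br \<psi>) X x y)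
             + cscale (\<psi> X) (tensor2 (ce_d br \<phi>) Y x y))))"

definition fn_bracket :: "('g::real_vector \<Rightarrow> 'g \<Rightarrow> 'g) \<Rightarrow> ('g \<Rightarrow> 'g) \<Rightarrow>
    ('g cplx \<Rightarrow> 'g cplx) \<Rightarrow> ('g cplx \<Rightarrow> 'g cplx) \<Rightarrow> 'g cplx \<Rightarrow> 'g cplx \<Rightarrow> 'g cplx" where
  "fn_bracket br J = (SOME F. is_fn_bracket br J F)"

section \<open>Well-definedness of the two operators\<close>

lemma clinear_form_iff:
  "clinear_form \<eta> \<longleftrightarrow> (\<forall>x y. \<eta> (x + y) = \<eta> x + \<eta> y) \<and> (\<forall>c x. \<eta> (cscale c x) = c * \<eta> x)"
proof -
  have "vector_space ((*) :: complex \<Rightarrow> complex \<Rightarrow> complex)"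
    by unfold_locales (auto simp: algebra_simps)
  then show ?thesis
    using vector_space_cscale
    by (auto simp: Vector_Spaces.linear_def module_hom_def module_hom_axioms_def
        vector_space_def module_def)
qed

lemma clinear_map_iff:
  "clinear_map \<Phi> \<longleftrightarrow> (\<forall>x y. \<Phi> (x + y) = \<Phi> x + \<Phi> y) \<and> (\<forall>c x. \<Phi> (cscale c x) = cscale c (\<Phi> x))"
  using vector_space_cscale
  by (auto simp: Vector_Spaces.linear_def module_hom_def module_hom_axioms_def
      vector_space_def module_def)

lemma cscale_simps [simp]:
  "cscale c (x + y) = cscale c x + cscale c y"
  "cscale c (x - y) = cscale c x - cscale c y"
  "cscale c (- x) = - cscale c x"
  "cscale c (cscale d x) = cscale (c * d) x"
  "cscale c 0 = 0" "cscale 0 x = 0" "cscale 1 x = x"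
  by (auto simp: cscale_def algebra_simps zero_prod_def)

lemma cscale_left:
  "cscale (c + d) x = cscale c x + cscale d x"
  "cscale (c - d) x = cscale c x - cscale d x"
  "cscale (- c) x = - cscale c x"
  by (auto simp: cscale_def algebra_simps)

lemma cscale_half_double: "cscale (1/2) x + cscale (1/2) x = x"
  using cscale_left(1)[of "1/2" "1/2" x] by simp

context
  fixes br :: "'g::real_vector \<Rightarrow> 'g \<Rightarrow> 'g" and J :: "'g \<Rightarrow> 'g"
  assumes cs: "lie_algebra_with_cs br J"
begin

lemma br_bilinear: "bilinear br" and br_self: "br x x = 0"
  using cs unfolding lie_algebra_with_cs_def lie_algebra_def by blast+

lemmas br_simps =
  bilinear_ladd[OF br_bilinear] bilinear_radd[OF br_bilinear]
  bilinear_lsub[OF br_bilinear] bilinear_rsub[OF br_bilinear]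
  bilinear_lmul[OF br_bilinear] bilinear_rmul[OF br_bilinear]
  bilinear_lneg[OF br_bilinear] bilinear_rneg[OF br_bilinear]

lemma cbr_add: "cbr br (x + x') y = cbr br x y + cbr br x' y" "cbr br x (y + y') = cbr br x y + cbr br x y'"
  by (auto simp: cbr_def br_simps)

lemma cbr_scale: "cbr br (cscale c x) y = cscale c (cbr br x y)" "cbr br x (cscale c y) = cscale c (cbr br x y)"
  by (auto simp: cbr_def cscale_def br_simps algebra_simps)

lemma cbr_zero: "cbr br 0 y = 0" "cbr br x 0 = 0"
  using cbr_scale(1)[of 0 0 y] cbr_scale(2)[of x 0 0] by simp_all

lemma cbr_minus: "cbr br (- x) y = - cbr br x y" "cbr br x (- y) = - cbr br x y"
  using cbr_scale(1)[of "-1" x y] cbr_scale(2)[of x "-1" y] by (simp_all add: cscale_left)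

lemma br_skew: "br x y = - br y x"
proof -
  have "br x y + br y x = br (x + y) (x + y) - br x x - br y y"
    by (simp add: bilinear_ladd[OF br_bilinear] bilinear_radd[OF br_bilinear])
  then have "br x y + br y x = 0" by (simp only: br_self) simp
  then show ?thesis by (rule eq_neg_iff_add_eq_0[THEN iffD2])
qed

lemma J_linear: "linear J" and J_sq: "J (J x) = - x"
  and J_int: "br (J x) (J y) - br x y - J (br (J x) y) - J (br x (J y)) = 0"
  using cs unfolding lie_algebra_with_cs_def complex_structure_def by blast+

lemma cmapJ: "cmap J (x + y) = cmap J x + cmap J y" "cmap J (cscale c x) = cscale c (cmap J x)"
  "cmap J (x - y) = cmap J x - cmap J y" "cmap J (- x) = - cmap J x"
  "cmap J (cmap J x) = - x"
  by (auto simp: cmap_def cscale_def prod_eq_iff J_sq linear_add[OF J_linear] linear_diff[OF J_linear]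
      linear_scale[OF J_linear] linear_neg[OF J_linear])

lemma g10_closed: "0 \<in> g10 J" "x \<in> g10 J \<Longrightarrow> y \<in> g10 J \<Longrightarrow> x + y \<in> g10 J"
  "x \<in> g10 J \<Longrightarrow> cscale c x \<in> g10 J" "x \<in> g10 J \<Longrightarrow> y \<in> g10 J \<Longrightarrow> x - y \<in> g10 J"
  "x \<in> g10 J \<Longrightarrow> - x \<in> g10 J"
  using cmapJ(2)[of 0 0] by (auto simp: g10_def cmapJ mult.commute)

lemma pr10_in: "pr10 J x \<in> g10 J"
  by (simp add: g10_def pr10_def cmapJ cscale_left algebra_simps)

lemma pr01_in: "pr01 J x \<in> g01 J"
  by (simp add: g01_def pr01_def cmapJ cscale_left algebra_simps)

lemma pr_sum: "pr10 J x + pr01 J x = x"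
  by (simp add: pr10_def pr01_def cscale_half_double)

lemma pr10_on: "x \<in> g10 J \<Longrightarrow> pr10 J x = x"
  by (simp add: g10_def pr10_def cscale_left cscale_half_double)

lemma pr01_on: "x \<in> g10 J \<Longrightarrow> pr01 J x = 0"
  by (simp add: g10_def pr01_def cscale_left)

lemma pr_lin: "pr10 J (x + y) = pr10 J x + pr10 J y" "pr10 J (cscale c x) = cscale c (pr10 J x)"
  "pr01 J (x + y) = pr01 J x + pr01 J y" "pr01 J (cscale c x) = cscale c (pr01 J x)"
  "pr10 J (x - y) = pr10 J x - pr10 J y" "pr10 J (- x) = - pr10 J x"
  by (auto simp: pr10_def pr01_def cmapJ algebra_simps)

lemma cbr_g10:
  assumes "x \<in> g10 J" "y \<in> g10 J" shows "cbr br x y \<in> g10 J"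
proof -
  obtain a b where x: "x = (a, b)" by force
  obtain c d where y: "y = (c, d)" by force
  have "b = - J a" "d = - J c"
    using assms by (auto simp: x y g10_def cmap_def cscale_def)
  then have x: "x = (a, - J a)" and y: "y = (c, - J c)" by (auto simp: x y)
  have eq: "cbr br x y = (br a c - br (J a) (J c), - (br a (J c) + br (J a) c))"
    by (simp add: x y cbr_def br_simps)
  have i1: "br (J a) (J c) - br a c = J (br (J a) c + br a (J c))"
    using J_int[of a c] by (simp add: linear_add[OF J_linear] algebra_simps)
  have i2: "J (br (J a) (J c) - br a c) = - (br (J a) c + br a (J c))"
    by (simp only: i1 J_sq)
  have i2': "J (br a c - br (J a) (J c)) = br (J a) c + br a (J c)"
    using i2 linear_neg[OF J_linear, of "br (J a) (J c) - br a c"] by simp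
  have i1': "J (- (br a (J c) + br (J a) c)) = br a c - br (J a) (J c)"
  proof -
    have "J (- (br a (J c) + br (J a) c)) = - J (br (J a) c + br a (J c))"
      by (simp only: linear_neg[OF J_linear] add.commute)
    also have "\<dots> = br a c - br (J a) (J c)"
      by (simp only: i1[symmetric] minus_diff_eq)
    finally show ?thesis .
  qed
  show ?thesis
    unfolding g10_def eq using i1' i2' by (simp add: cmap_def cscale_def add.commute)
qed

lemma Lam01_add: "\<eta> \<in> Lam01 J \<Longrightarrow> \<eta> (x + y) = \<eta> x + \<eta> y"
  and Lam01_scale: "\<eta> \<in> Lam01 J \<Longrightarrow> \<eta> (cscale c x) = c * \<eta> x"
  and Lam01_g10_0: "\<eta> \<in> Lam01 J \<Longrightarrow> x \<in> g10 J \<Longrightarrow> \<eta> x = 0"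
  unfolding Lam01_def clinear_form_iff by blast+

lemma V_add: "\<Phi> \<in> Lam01_g10 J \<Longrightarrow> \<Phi> (x + y) = \<Phi> x + \<Phi> y"
  and V_scale: "\<Phi> \<in> Lam01_g10 J \<Longrightarrow> \<Phi> (cscale c x) = cscale c (\<Phi> x)"
  and V_0: "\<Phi> \<in> Lam01_g10 J \<Longrightarrow> x \<in> g10 J \<Longrightarrow> \<Phi> x = 0"
  and V_in: "\<Phi> \<in> Lam01_g10 J \<Longrightarrow> \<Phi> x \<in> g10 J"
  unfolding Lam01_g10_def clinear_map_iff by blast+

lemma V_neg: "\<Phi> \<in> Lam01_g10 J \<Longrightarrow> \<Phi> (- x) = - \<Phi> x"
  using V_scale[of \<Phi> "-1" x] by (simp add: cscale_left)

lemma V_pr01: "\<Phi> \<in> Lam01_g10 J \<Longrightarrow> \<Phi> (pr01 J x) = \<Phi> x"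
  using V_add[of \<Phi> "pr10 J x" "pr01 J x"] by (simp add: pr_sum V_0 pr10_in)

lemma V_closed:
  "(\<lambda>x. 0) \<in> Lam01_g10 J"
  "\<Phi> \<in> Lam01_g10 J \<Longrightarrow> \<Psi> \<in> Lam01_g10 J \<Longrightarrow> (\<lambda>x. \<Phi> x + \<Psi> x) \<in> Lam01_g10 J"
  "\<Phi> \<in> Lam01_g10 J \<Longrightarrow> (\<lambda>x. cscale c (\<Phi> x)) \<in> Lam01_g10 J"
  unfolding Lam01_g10_def clinear_map_iff
  by (simp_all add: g10_closed mult.commute algebra_simps del: split_paired_All)

lemma tensor1_in: "\<eta> \<in> Lam01 J \<Longrightarrow> Y \<in> g10 J \<Longrightarrow> tensor1 \<eta> Y \<in> Lam01_g10 J"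
  unfolding Lam01_g10_def clinear_map_iff
  by (simp add: tensor1_def g10_closed Lam01_add Lam01_scale Lam01_g10_0 cscale_left del: split_paired_All)

lemma tensor_induct [consumes 1, case_names zero add pure]:
  assumes \<Phi>: "\<Phi> \<in> Lam01_g10 J"
    and zero: "P (\<lambda>x. 0)"
    and add: "\<And>\<Phi> \<Psi>. \<Phi> \<in> Lam01_g10 J \<Longrightarrow> \<Psi> \<in> Lam01_g10 J \<Longrightarrow> P \<Phi> \<Longrightarrow> P \<Psi> \<Longrightarrow> P (\<lambda>x. \<Phi> x + \<Psi> x)"
    and pure: "\<And>\<eta> Y. \<eta> \<in> Lam01 J \<Longrightarrow> Y \<in> g10 J \<Longrightarrow> P (tensor1 \<eta> Y)"
  shows "P \<Phi>"
proof -
  obtain S :: "'g set" where S: "finite S" "span S = UNIV"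
    using cs by (auto simp: lie_algebra_with_cs_def)
  obtain B where B: "B \<subseteq> S" "independent B" "S \<subseteq> span B"
    using maximal_independent_subset by blast
  have finB: "finite B" using B S finite_subset by blast
  have spB: "v \<in> span B" for v
    using B(3) S(2) by (metis UNIV_I span_mono span_span subsetD)
  define r where "r v b = representation B v b" for v b
  define co where "co b z = Complex (r (fst z) b) (r (snd z) b)" for b z
  have r_add: "r (u + v) b = r u b + r v b" and r_scale: "r (c *\<^sub>R u) b = c * r u b"
    and r_diff: "r (u - v) b = r u b - r v b" for u v b c
    using B(2) spB
    by (auto simp: r_def real_vector.representation_add real_vector.representation_scale
        real_vector.representation_diff)
  have co_add: "co b (u + v) = co b u + co b v" and co_scale: "co b (cscale c u) = c * co b u" for u v b c
    by (auto simp: co_def complex_eq_iff r_add r_diff r_scale cscale_def)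
  have r_sum: "(\<Sum>b\<in>B. r v b *\<^sub>R b) = v" for v
    unfolding r_def by (rule real_vector.sum_representation_eq[OF B(2) spB finB]) simp
  have co_sum: "(\<Sum>b\<in>B. cscale (co b z) (b, 0)) = z" for z
    by (rule prod_eqI) (simp_all add: fst_sum snd_sum cscale_def co_def r_sum)
  have pr_sm: "pr10 J (\<Sum>b\<in>A. f b) = (\<Sum>b\<in>A. pr10 J (f b))" if "finite A" for A :: "'g set" and f
    using that
    by (induction A) (use pr_lin(2)[of 0 0] in \<open>auto simp: pr_lin\<close>)
  define e where "e b = (\<lambda>x. co b (\<Phi> x))" for b
  define Y where "Y b = pr10 J (b, 0)" for b
  have e_in: "e b \<in> Lam01 J" for b
    unfolding e_def Lam01_def clinear_form_iff using co_scale[of b 0 0]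
    by (simp add: V_add[OF \<Phi>] V_scale[OF \<Phi>] V_0[OF \<Phi>] co_add co_scale del: split_paired_All)
  have Y_in: "Y b \<in> g10 J" for b by (simp add: Y_def pr10_in)
  have "\<Phi> x = (\<Sum>b\<in>B. tensor1 (e b) (Y b) x)" for x
  proof -
    have "\<Phi> x = pr10 J (\<Sum>b\<in>B. cscale (co b (\<Phi> x)) (b, 0))"
      by (simp add: co_sum pr10_on V_in[OF \<Phi>])
    then show ?thesis by (simp add: pr_sm finB pr_lin tensor1_def e_def Y_def)
  qed
  then have eq: "\<Phi> = (\<lambda>x. \<Sum>b\<in>B. tensor1 (e b) (Y b) x)" by blast
  have "(\<lambda>x. \<Sum>b\<in>A. tensor1 (e b) (Y b) x) \<in> Lam01_g10 J \<and> P (\<lambda>x. \<Sum>b\<in>A. tensor1 (e b) (Y b) x)"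
    if "finite A" for A
    using that
  proof (induction A)
    case empty
    then show ?case by (simp add: zero V_closed)
  next
    case (insert b A)
    then show ?case
      using V_closed(2)[OF tensor1_in[OF e_in Y_in]] add[OF tensor1_in[OF e_in Y_in]] pure[OF e_in Y_in]
      by simp
  qed
  from this[OF finB] show ?thesis using eq by simp
qed

definition dbar_expl :: "('g cplx \<Rightarrow> 'g cplx) \<Rightarrow> 'g cplx \<Rightarrow> 'g cplx \<Rightarrow> 'g cplx" where
  "dbar_expl \<Phi> x y = pr10 J (cbr br (pr01 J x) (\<Phi> y)) - pr10 J (cbr br (pr01 J y) (\<Phi> x))
     - \<Phi> (cbr br (pr01 J x) (pr01 J y))"

definition fn_expl :: "('g cplx \<Rightarrow> 'g cplx) \<Rightarrow> ('g cplx \<Rightarrow> 'g cplx) \<Rightarrow> 'g cplx \<Rightarrow> 'g cplx \<Rightarrow> 'g cplx" where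
  "fn_expl \<Phi> \<Psi> x y = cbr br (\<Phi> x) (\<Psi> y) - cbr br (\<Phi> y) (\<Psi> x)
     + \<Phi> (cbr br (\<Psi> y) x) - \<Phi> (cbr br (\<Psi> x) y) + \<Psi> (cbr br (\<Phi> y) x) - \<Psi> (cbr br (\<Phi> x) y)"

lemma cbr_self: "cbr br x x = 0"
  using br_skew[of "fst x" "snd x"] by (simp add: cbr_def br_self zero_prod_def)

lemma dbar_expl_in: "\<Phi> \<in> Lam01_g10 J \<Longrightarrow> dbar_expl \<Phi> \<in> Lam02_g10 J"
  using pr_lin(2)[of 0 0] V_scale[of \<Phi> 0 0]
  unfolding Lam02_g10_def clinear_map_iff dbar_expl_def
  by (simp add: V_add V_scale V_0 pr01_on cbr_add cbr_scale cbr_zero cbr_self pr_lin V_in pr10_in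
      g10_closed del: split_paired_All)

lemma fn_expl_in:
  assumes \<Phi>: "\<Phi> \<in> Lam01_g10 J" and \<Psi>: "\<Psi> \<in> Lam01_g10 J"
  shows "fn_expl \<Phi> \<Psi> \<in> Lam02_g10 J"
proof -
  define A where "A \<Phi> \<Psi> x y = \<Phi> (cbr br (\<Psi> y) x) - \<Phi> (cbr br (\<Psi> x) y)" for \<Phi> \<Psi> :: "'g cplx \<Rightarrow> 'g cplx" and x y
  define C where "C x y = cbr br (\<Phi> x) (\<Psi> y) - cbr br (\<Phi> y) (\<Psi> x)" for x y
  have expl: "fn_expl \<Phi> \<Psi> x y = C x y + A \<Phi> \<Psi> x y + A \<Psi> \<Phi> x y" for x y
    by (simp add: fn_expl_def A_def C_def)
  have A: "A \<Phi> \<Psi> (x + x') y = A \<Phi> \<Psi> x y + A \<Phi> \<Psi> x' y"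
      "A \<Phi> \<Psi> x (y + y') = A \<Phi> \<Psi> x y + A \<Phi> \<Psi> x y'"
      "A \<Phi> \<Psi> (cscale c x) y = cscale c (A \<Phi> \<Psi> x y)"
      "A \<Phi> \<Psi> x (cscale c y) = cscale c (A \<Phi> \<Psi> x y)"
      "A \<Phi> \<Psi> x x = 0" "A \<Phi> \<Psi> x y \<in> g10 J" "x \<in> g10 J \<Longrightarrow> A \<Phi> \<Psi> x y = 0"
    if \<Phi>: "\<Phi> \<in> Lam01_g10 J" and \<Psi>: "\<Psi> \<in> Lam01_g10 J" for \<Phi> \<Psi> x x' y y' c
    using V_scale[OF \<Phi>, of 0 0]
    by (simp_all add: A_def V_add[OF \<Phi>] V_add[OF \<Psi>] V_scale[OF \<Phi>] V_scale[OF \<Psi>] cbr_add cbr_scale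
        cbr_zero cbr_g10 V_0[OF \<Phi>] V_0[OF \<Psi>] V_in[OF \<Phi>] V_in[OF \<Psi>] g10_closed)
  have C: "C (x + x') y = C x y + C x' y" "C x (y + y') = C x y + C x y'"
      "C (cscale c x) y = cscale c (C x y)" "C x (cscale c y) = cscale c (C x y)"
      "C x x = 0" "C x y \<in> g10 J" "x \<in> g10 J \<Longrightarrow> C x y = 0" for x x' y y' c
    by (simp_all add: C_def V_add[OF \<Phi>] V_add[OF \<Psi>] V_scale[OF \<Phi>] V_scale[OF \<Psi>] cbr_add cbr_scale
        cbr_zero cbr_g10 V_0[OF \<Phi>] V_0[OF \<Psi>] V_in[OF \<Phi>] V_in[OF \<Psi>] g10_closed)
  show ?thesis
    unfolding Lam02_g10_def clinear_map_iff
    by (simp add: expl A[OF \<Phi> \<Psi>] A[OF \<Psi> \<Phi>] C g10_closed del: split_paired_All)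
qed

lemma is_dbar_expl: "is_dbar br J dbar_expl"
proof -
  have "dbar_expl (tensor1 \<eta> Y) = (\<lambda>x y. tensor2 (dbar_form br J \<eta>) Y x y - wedge_vec \<eta> (dbar_vec br J Y) x y)"
    if "\<eta> \<in> Lam01 J" "Y \<in> g10 J" for \<eta> Y
    using that
    by (simp add: fun_eq_iff dbar_expl_def tensor1_def tensor2_def dbar_form_def ce_d_def
        wedge_vec_def dbar_vec_def cbr_scale pr_lin cscale_left
        del: split_paired_All)
  then show ?thesis
    unfolding is_dbar_def
    by (simp add: dbar_expl_in dbar_expl_def fun_eq_iff cbr_add cbr_scale pr_lin algebra_simps
        del: split_paired_All)
qed

lemma is_fn_bracket_expl: "is_fn_bracket br J fn_expl"
proof -
  have "fn_expl (tensor1 \<phi> X) (tensor1 \<psi> Y) = (\<lambda>x y.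
          tensor2 (wedge \<phi> \<psi>) (cbr br X Y) x y
          - (tensor2 (wedge (contract Y (ce_d br \<phi>)) \<psi>) X x y
             + tensor2 (wedge (contract X (ce_d br \<psi>)) \<phi>) Y x y
             + cscale (\<phi> Y) (tensor2 (ce_d br \<psi>) X x y)
             + cscale (\<psi> X) (tensor2 (ce_d br \<phi>) Y x y)))"
    if "\<phi> \<in> Lam01 J" "X \<in> g10 J" "\<psi> \<in> Lam01 J" "Y \<in> g10 J" for \<phi> X \<psi> Y
    using that
    by (simp add: fun_eq_iff fn_expl_def tensor1_def tensor2_def ce_d_def wedge_def contract_def
        cbr_scale cscale_left Lam01_scale Lam01_g10_0 algebra_simps del: split_paired_All)
  then show ?thesis
    unfolding is_fn_bracket_def
    by (simp add: fn_expl_in fn_expl_def fun_eq_iff cbr_add cbr_scale V_add V_scale algebra_simps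
        del: split_paired_All)
qed

lemma is_dbar_apply:
  assumes D: "is_dbar br J D" and \<Phi>: "\<Phi> \<in> Lam01_g10 J"
  shows "D \<Phi> x y = pr10 J (cbr br (pr01 J x) (\<Phi> y)) - pr10 J (cbr br (pr01 J y) (\<Phi> x))
     - \<Phi> (cbr br (pr01 J x) (pr01 J y))"
proof -
  have E0: "E (\<lambda>x. 0) = (\<lambda>x y. 0)" if "is_dbar br J E" for E
  proof -
    have scale: "E (\<lambda>x. cscale c (\<Phi> x)) = (\<lambda>x y. cscale c (E \<Phi> x y))" if "\<Phi> \<in> Lam01_g10 J" for c \<Phi>
      using \<open>is_dbar br J E\<close> that unfolding is_dbar_def by blast
    show ?thesis using scale[of "\<lambda>x. 0" 0, OF V_closed(1)] by simp
  qed
  have "D \<Phi> = dbar_expl \<Phi>"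
    using \<Phi>
  proof (induction \<Phi> rule: tensor_induct)
    case zero
    then show ?case using E0 D is_dbar_expl by simp
  next
    case (add \<Phi> \<Psi>)
    then show ?case using D is_dbar_expl unfolding is_dbar_def by simp
  next
    case (pure \<eta> Y)
    then show ?case using D is_dbar_expl unfolding is_dbar_def by simp
  qed
  then show ?thesis by (simp add: dbar_expl_def)
qed

lemma is_fn_bracket_apply:
  assumes F: "is_fn_bracket br J F" and \<Phi>: "\<Phi> \<in> Lam01_g10 J" and \<Psi>: "\<Psi> \<in> Lam01_g10 J"
  shows "F \<Phi> \<Psi> x y = cbr br (\<Phi> x) (\<Psi> y) - cbr br (\<Phi> y) (\<Psi> x)
     + \<Phi> (cbr br (\<Psi> y) x) - \<Phi> (cbr br (\<Psi> x) y) + \<Psi> (cbr br (\<Phi> y) x) - \<Psi> (cbr br (\<Phi> x) y)"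
proof -
  have E0: "E (\<lambda>x. 0) \<Theta> = (\<lambda>x y. 0)" "E \<Theta> (\<lambda>x. 0) = (\<lambda>x y. 0)"
    if E: "is_fn_bracket br J E" and \<Theta>: "\<Theta> \<in> Lam01_g10 J" for E \<Theta>
  proof -
    have scale: "E (\<lambda>x. cscale c (\<Phi> x)) \<Psi> = (\<lambda>x y. cscale c (E \<Phi> \<Psi> x y)) \<and>
        E \<Psi> (\<lambda>x. cscale c (\<Phi> x)) = (\<lambda>x y. cscale c (E \<Psi> \<Phi> x y))"
      if "\<Phi> \<in> Lam01_g10 J" "\<Psi> \<in> Lam01_g10 J" for c \<Phi> \<Psi>
      using E that unfolding is_fn_bracket_def by blast
    show "E (\<lambda>x. 0) \<Theta> = (\<lambda>x y. 0)" "E \<Theta> (\<lambda>x. 0) = (\<lambda>x y. 0)"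
      using scale[of "\<lambda>x. 0" \<Theta> 0, OF V_closed(1) \<Theta>] by simp_all
  qed
  have add1: "E (\<lambda>x. \<Phi> x + \<Phi>' x) \<Psi> = (\<lambda>x y. E \<Phi> \<Psi> x y + E \<Phi>' \<Psi> x y)"
    and add2: "E \<Psi> (\<lambda>x. \<Phi> x + \<Phi>' x) = (\<lambda>x y. E \<Psi> \<Phi> x y + E \<Psi> \<Phi>' x y)"
    if "is_fn_bracket br J E" "\<Phi> \<in> Lam01_g10 J" "\<Phi>' \<in> Lam01_g10 J" "\<Psi> \<in> Lam01_g10 J" for E \<Phi> \<Phi>' \<Psi>
    using that unfolding is_fn_bracket_def by blast+
  have "F \<Phi> \<Psi> = fn_expl \<Phi> \<Psi>"
    using \<Phi>
  proof (induction \<Phi> rule: tensor_induct)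
    case zero
    then show ?case using E0(1)[OF F \<Psi>] E0(1)[OF is_fn_bracket_expl \<Psi>] by simp
  next
    case (add \<Phi> \<Phi>')
    then show ?case using add1[OF F _ _ \<Psi>] add1[OF is_fn_bracket_expl _ _ \<Psi>] by simp
  next
    case (pure \<eta> Y)
    note T = tensor1_in[OF pure]
    show ?case
      using \<Psi>
    proof (induction \<Psi> rule: tensor_induct)
      case zero
      then show ?case using E0(2)[OF F T] E0(2)[OF is_fn_bracket_expl T] by simp
    next
      case (add \<Phi> \<Phi>')
      then show ?case using add2[OF F _ _ T] add2[OF is_fn_bracket_expl _ _ T] by simp
    next
      case (pure \<theta> Z)
      then show ?case using \<open>\<eta> \<in> Lam01 J\<close> \<open>Y \<in> g10 J\<close> F is_fn_bracket_expl
        unfolding is_fn_bracket_def by simp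
    qed
  qed
  then show ?thesis by (simp add: fn_expl_def)
qed

lemma is_dbar_dbar: "is_dbar br J (dbar br J)"
  unfolding dbar_def by (rule someI[of "is_dbar br J", OF is_dbar_expl])

lemma is_fn_bracket_fn_bracket: "is_fn_bracket br J (fn_bracket br J)"
  unfolding fn_bracket_def by (rule someI[of "is_fn_bracket br J", OF is_fn_bracket_expl])

end

section \<open>Holomorphic maps and analytic sets\<close>

text \<open>
  The dimension has to vary inside the statement, so \<open>\<complex>\<^sup>m\<close> is the set of sequences that vanish from
  index \<open>m\<close> on. The product topology of \<^typ>\<open>nat \<Rightarrow> complex\<close> induces the usual topology on it.
\<close>

definition Cn :: "nat \<Rightarrow> (nat \<Rightarrow> complex) set" where
  "Cn m = {t. \<forall>i\<ge>m. t i = 0}"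

abbreviation origin :: "nat \<Rightarrow> complex" where
  "origin \<equiv> \<lambda>_. 0"

definition open_Cn :: "nat \<Rightarrow> (nat \<Rightarrow> complex) set \<Rightarrow> bool" where
  "open_Cn m U \<longleftrightarrow> openin (top_of_set (Cn m)) U"

definition polydisc :: "nat \<Rightarrow> (nat \<Rightarrow> complex) set" where
  "polydisc m = {t \<in> Cn m. \<forall>i<m. cmod (t i) < 1}"

text \<open>Holomorphic functions of several variables on an open set: continuous and holomorphic in each variable.\<close>

definition holo_open :: "nat \<Rightarrow> (nat \<Rightarrow> complex) set \<Rightarrow> ((nat \<Rightarrow> complex) \<Rightarrow> complex) \<Rightarrow> bool" where
  "holo_open m U f \<longleftrightarrow> continuous_on U f \<and>
     (\<forall>a\<in>U. \<forall>i<m. (\<lambda>z. f (a(i := z))) holomorphic_on {z. a(i := z) \<in> U})"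

definition analytic_subset :: "nat \<Rightarrow> (nat \<Rightarrow> complex) set \<Rightarrow> bool" where
  "analytic_subset m B \<longleftrightarrow> B \<subseteq> polydisc m \<and>
     (\<forall>p\<in>polydisc m. \<exists>U F. open_Cn m U \<and> p \<in> U \<and> U \<subseteq> polydisc m \<and> finite F \<and>
        (\<forall>f\<in>F. holo_open m U f) \<and> B \<inter> U = {z\<in>U. \<forall>f\<in>F. f z = 0})"

text \<open>On an analytic set, holomorphic means locally the restriction of a holomorphic function on an open set.\<close>

definition holo_on :: "nat \<Rightarrow> (nat \<Rightarrow> complex) set \<Rightarrow> ((nat \<Rightarrow> complex) \<Rightarrow> complex) \<Rightarrow> bool" where
  "holo_on m S f \<longleftrightarrow> (\<forall>p\<in>S. \<exists>U g. open_Cn m U \<and> p \<in> U \<and> holo_open m U g \<and> (\<forall>z\<in>S \<inter> U. f z = g z))"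

text \<open>Maps into the (finite-dimensional) complexification: holomorphic in every linear coordinate.\<close>

definition holo_vec_on :: "nat \<Rightarrow> (nat \<Rightarrow> complex) set \<Rightarrow> ((nat \<Rightarrow> complex) \<Rightarrow> 'g::real_vector cplx) \<Rightarrow> bool" where
  "holo_vec_on m S F \<longleftrightarrow> (\<forall>\<alpha>. clinear_form \<alpha> \<longrightarrow> holo_on m S (\<lambda>t. \<alpha> (F t)))"

definition holo_map_on :: "nat \<Rightarrow> (nat \<Rightarrow> complex) set \<Rightarrow> nat \<Rightarrow> (nat \<Rightarrow> complex) set \<Rightarrow>
    ((nat \<Rightarrow> complex) \<Rightarrow> nat \<Rightarrow> complex) \<Rightarrow> bool" where
  "holo_map_on l S m B h \<longleftrightarrow> (\<forall>s\<in>S. h s \<in> B) \<and> (\<forall>i<m. holo_on l S (\<lambda>s. h s i))"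

section \<open>Deformations\<close>

definition holomorphic_deformation :: "('g::real_vector \<Rightarrow> 'g \<Rightarrow> 'g) \<Rightarrow> ('g \<Rightarrow> 'g) \<Rightarrow>
    nat \<Rightarrow> (nat \<Rightarrow> complex) set \<Rightarrow> ((nat \<Rightarrow> complex) \<Rightarrow> 'g cplx \<Rightarrow> 'g cplx) \<Rightarrow> bool" where
  "holomorphic_deformation br J m B \<phi> \<longleftrightarrow>
     analytic_subset m B \<and> origin \<in> B \<and>
     (\<forall>t\<in>B. \<phi> t \<in> Lam01_g10 J) \<and>
     (\<forall>x. holo_vec_on m B (\<lambda>t. \<phi> t x)) \<and>
     \<phi> origin = (\<lambda>x. 0) \<and>
     (\<forall>t\<in>B. dbar br J (\<phi> t) = (\<lambda>x y. cscale (1/2) (fn_bracket br J (\<phi> t) (\<phi> t) x y)))"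

definition conj_map :: "('g::real_vector cplx \<Rightarrow> 'g cplx) \<Rightarrow> 'g cplx \<Rightarrow> 'g cplx" where
  "conj_map \<Phi> x = conj_cplx (\<Phi> (conj_cplx x))"

text \<open>\<open>K\<close> is the complex structure determined by \<open>\<Phi>\<close>. There is at most one, see \<open>induced_cs_unique\<close>.\<close>

definition induced_cs :: "('g::real_vector \<Rightarrow> 'g \<Rightarrow> 'g) \<Rightarrow> ('g \<Rightarrow> 'g) \<Rightarrow>
    ('g cplx \<Rightarrow> 'g cplx) \<Rightarrow> ('g \<Rightarrow> 'g) \<Rightarrow> bool" where
  "induced_cs br J \<Phi> K \<longleftrightarrow> complex_structure br K \<and>
     g01 K = (\<lambda>x. x - \<Phi> x) ` g01 J \<and>
     g10 K = (\<lambda>x. x - conj_map \<Phi> x) ` g10 J"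

lemma induced_cs_unique:
  assumes "induced_cs br J \<Phi> K" "induced_cs br J \<Phi> K'"
  shows "K = K'"
proof
  fix x
  have K: "linear K" "K (K x) = - x" and K': "linear K'" and eq: "g10 K = g10 K'"
    using assms by (auto simp: induced_cs_def complex_structure_def)
  have "(x, - K x) \<in> g10 K"
    using K by (simp add: g10_def cmap_def cscale_def linear_neg)
  then have "(x, - K x) \<in> g10 K'" using eq by simp
  then show "K x = K' x" by (simp add: g10_def cmap_def cscale_def)
qed

definition lie_automorphism :: "('g::real_vector \<Rightarrow> 'g \<Rightarrow> 'g) \<Rightarrow> ('g \<Rightarrow> 'g) \<Rightarrow> bool" where
  "lie_automorphism br f \<longleftrightarrow> linear f \<and> bij f \<and> (\<forall>x y. f (br x y) = br (f x) (f y))"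

definition equivalent_over :: "('g::real_vector \<Rightarrow> 'g \<Rightarrow> 'g) \<Rightarrow> ('g \<Rightarrow> 'g) \<Rightarrow>
    nat \<Rightarrow> (nat \<Rightarrow> complex) set \<Rightarrow> ((nat \<Rightarrow> complex) \<Rightarrow> 'g cplx \<Rightarrow> 'g cplx) \<Rightarrow>
    ((nat \<Rightarrow> complex) \<Rightarrow> 'g cplx \<Rightarrow> 'g cplx) \<Rightarrow> bool" where
  "equivalent_over br J m S \<phi> \<phi>' \<longleftrightarrow>
     (\<exists>f. (\<forall>t\<in>S. lie_automorphism br (f t)) \<and>
          (\<forall>x. holo_vec_on m S (\<lambda>t. cmap (f t) x)) \<and>
          (\<forall>t\<in>S. \<exists>K K'. induced_cs br J (\<phi> t) K \<and> induced_cs br J (\<phi>' t) K' \<and>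
             K' = inv (f t) \<circ> K \<circ> f t))"

text \<open>
  Small deformations are germs at the origin, represented here by deformations. Germs of maps on \<open>D\<close>
  and equivalence of germs are expressed on \<open>D \<inter> W\<close> for some neighbourhood \<open>W\<close> of the origin.
\<close>

definition complete_deformation :: "('g::real_vector \<Rightarrow> 'g \<Rightarrow> 'g) \<Rightarrow> ('g \<Rightarrow> 'g) \<Rightarrow>
    nat \<Rightarrow> (nat \<Rightarrow> complex) set \<Rightarrow> ((nat \<Rightarrow> complex) \<Rightarrow> 'g cplx \<Rightarrow> 'g cplx) \<Rightarrow> bool" where
  "complete_deformation br J m B \<phi> \<longleftrightarrow>
     holomorphic_deformation br J m B \<phi> \<and>
     (\<forall>l D \<psi>. holomorphic_deformation br J l D \<psi> \<longrightarrow>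
        (\<exists>W h. open_Cn l W \<and> origin \<in> W \<and>
           holo_map_on l (D \<inter> W) m B h \<and> h origin = origin \<and>
           equivalent_over br J l (D \<inter> W) \<psi> (\<lambda>s. \<phi> (h s))))"

end

theory Submission
  imports Defs
begin

text \<open>
  No slice transversal to the orbits of the automorphism group is needed: completeness only asks
  for the existence of the classifying map \<open>h\<close>. So one takes for \<open>B\<close> the space of \<^emph>\<open>all\<close> small
  solutions of the integrability equation, parametrised tautologically by their matrix entries in a
  basis, for \<open>h(s)\<close> the matrix of \<open>\<psi>(s)\<close>, and for \<open>f\<^sub>t\<close> the identity. The equations are polynomial in
  the matrix entries. What remains is that a small solution \<open>\<Phi>\<close> really induces a complex structure:
  it is \<open>\<tau> \<circ> J \<circ> \<tau>\<^sup>-\<^sup>1\<close> with \<open>\<tau>\<close> the real form of \<open>1 - \<Phi> - conj \<Phi>\<close>, and the integrability equation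
  says that \<open>(1 - \<Phi>) g\<^sup>0\<^sup>,\<^sup>1\<close> is a subalgebra.
\<close>

section \<open>Holomorphic functions\<close>

lemma holo_open_const: "holo_open m U (\<lambda>_. c)"
  by (simp add: holo_open_def)

lemma holo_open_coordinate: "holo_open m U (\<lambda>t. t i)"
proof -
  have "(\<lambda>z. (a(j := z)) i) holomorphic_on A" for a :: "nat \<Rightarrow> complex" and j A
    by (cases "i = j") auto
  moreover have "continuous_on U (\<lambda>t::nat \<Rightarrow> complex. t i)"
    by (rule continuous_on_product_coordinates[THEN continuous_on_subset]) simp
  ultimately show ?thesis unfolding holo_open_def by blast
qed

lemma holo_open_add: "holo_open m U f \<Longrightarrow> holo_open m U g \<Longrightarrow> holo_open m U (\<lambda>t. f t + g t)"
  unfolding holo_open_def by (auto intro!: continuous_on_add holomorphic_on_add)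

lemma holo_open_mult: "holo_open m U f \<Longrightarrow> holo_open m U g \<Longrightarrow> holo_open m U (\<lambda>t. f t * g t)"
  unfolding holo_open_def by (auto intro!: continuous_on_mult holomorphic_on_mult)

lemma holo_open_sum: "(\<And>a. a \<in> A \<Longrightarrow> holo_open m U (f a)) \<Longrightarrow> holo_open m U (\<lambda>t. \<Sum>a\<in>A. f a t)"
  by (induction A rule: infinite_finite_induct) (auto simp: holo_open_const intro!: holo_open_add)

lemma open_Cn_polydisc: "open_Cn m (polydisc m)"
proof -
  have "open (\<Inter>i\<in>{..<m}. {t::nat \<Rightarrow> complex. cmod (t i) < 1})"
    by (intro open_INT finite_lessThan ballI open_Collect_less continuous_on_norm
        continuous_on_const continuous_on_product_coordinates)
  moreover have "polydisc m = Cn m \<inter> (\<Inter>i\<in>{..<m}. {t. cmod (t i) < 1})"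
    by (auto simp: polydisc_def)
  ultimately show ?thesis
    unfolding open_Cn_def openin_open by blast
qed

lemma holo_on_const: "S \<subseteq> Cn m \<Longrightarrow> holo_on m S (\<lambda>_. c)"
  unfolding holo_on_def open_Cn_def by (metis holo_open_const openin_subtopology_self subsetD)

lemma holo_on_if_holo_open:
  "open_Cn m U \<Longrightarrow> S \<subseteq> U \<Longrightarrow> holo_open m U f \<Longrightarrow> holo_on m S f"
  unfolding holo_on_def by blast

lemma holo_on_subset: "holo_on m S f \<Longrightarrow> T \<subseteq> S \<Longrightarrow> holo_on m T f"
  unfolding holo_on_def by (meson IntD1 IntD2 IntI subsetD)

text \<open>The neighbourhood is the preimage of a ball under a local extension \<open>g\<close>,
  which is continuous on an open set; the bound passes to \<open>f\<close> only on \<open>S\<close>,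
  where it agrees with \<open>g\<close>. This is what allows a germ to be shrunk.\<close>

lemma holo_on_small_nbhd:
  assumes "holo_on m S f" "p \<in> S" "f p = 0" "e > 0"
  shows "\<exists>W. open_Cn m W \<and> p \<in> W \<and> (\<forall>s\<in>S \<inter> W. cmod (f s) < e)"
proof -
  obtain U g where U: "open_Cn m U" "p \<in> U" "holo_open m U g" "\<forall>z\<in>S \<inter> U. f z = g z"
    using assms unfolding holo_on_def by blast
  have "continuous_on U g" using U(3) by (simp add: holo_open_def)
  then have "openin (top_of_set U) (U \<inter> g -` ball 0 e)"
    by (rule continuous_openin_preimage_gen) simp
  then have "open_Cn m (U \<inter> g -` ball 0 e)"
    using U(1) unfolding open_Cn_def by (meson openin_trans openin_imp_subset)
  moreover have "p \<in> U \<inter> g -` ball 0 e" "\<forall>s\<in>S \<inter> (U \<inter> g -` ball 0 e). cmod (f s) < e"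
    using U assms by auto
  ultimately show ?thesis by blast
qed

lemma holo_on_small_nbhd_finite:
  assumes "finite I" "\<And>i. i \<in> I \<Longrightarrow> holo_on m S (f i)" "p \<in> S" "p \<in> Cn m"
    "\<And>i. i \<in> I \<Longrightarrow> f i p = 0" "e > 0"
  shows "\<exists>W. open_Cn m W \<and> p \<in> W \<and> (\<forall>s\<in>S \<inter> W. \<forall>i\<in>I. cmod (f i s) < e)"
  using assms(1,2,5)
proof (induction I)
  case empty
  then show ?case using assms(4) by (auto simp: open_Cn_def intro!: exI[of _ "Cn m"])
next
  case (insert i I)
  obtain W where W: "open_Cn m W" "p \<in> W" "\<forall>s\<in>S \<inter> W. \<forall>i\<in>I. cmod (f i s) < e"
    using insert by auto
  obtain V where V: "open_Cn m V" "p \<in> V" "\<forall>s\<in>S \<inter> V. cmod (f i s) < e"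
    using holo_on_small_nbhd[OF insert.prems(1) assms(3) insert.prems(2) assms(6)] by blast
  show ?case
    using W V by (intro exI[of _ "W \<inter> V"]) (auto simp: open_Cn_def)
qed

section \<open>Holomorphic maps from open sets into the complexification\<close>

text \<open>Counterpart of \<open>holo_vec_on\<close> on an open set: the equations cutting out an
  analytic set must be holomorphic on open sets and not only along the set itself.\<close>

definition holo_vec_open ::
    "nat \<Rightarrow> (nat \<Rightarrow> complex) set \<Rightarrow> ((nat \<Rightarrow> complex) \<Rightarrow> 'g::real_vector cplx) \<Rightarrow> bool" where
  "holo_vec_open m U F \<longleftrightarrow> (\<forall>\<alpha>. clinear_form \<alpha> \<longrightarrow> holo_open m U (\<lambda>t. \<alpha> (F t)))"

lemma holo_vec_open_const: "holo_vec_open m U (\<lambda>_. x)"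
  by (simp add: holo_vec_open_def holo_open_const)

lemma holo_vec_open_add:
  "holo_vec_open m U F \<Longrightarrow> holo_vec_open m U G \<Longrightarrow> holo_vec_open m U (\<lambda>t. F t + G t)"
  unfolding holo_vec_open_def clinear_form_iff by (auto intro!: holo_open_add simp del: split_paired_All)

lemma holo_vec_open_clinear:
  assumes "clinear_map L" "holo_vec_open m U F"
  shows "holo_vec_open m U (\<lambda>t. L (F t))"
  unfolding holo_vec_open_def
proof (intro allI impI)
  fix \<alpha> :: "'a cplx \<Rightarrow> complex"
  assume "clinear_form \<alpha>"
  then have "clinear_form (\<lambda>x. \<alpha> (L x))"
    using assms(1) unfolding clinear_form_iff clinear_map_iff by metis
  then show "holo_open m U (\<lambda>t. \<alpha> (L (F t)))"
    using assms(2) unfolding holo_vec_open_def by blast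
qed

lemma holo_vec_open_diff:
  assumes "holo_vec_open m U F" "holo_vec_open m U G"
  shows "holo_vec_open m U (\<lambda>t. F t - G t)"
proof -
  have "clinear_map uminus"
    by (simp add: clinear_map_iff del: split_paired_All)
  from holo_vec_open_add[OF assms(1) holo_vec_open_clinear[OF this assms(2)]] show ?thesis by simp
qed

section \<open>Coordinates\<close>

locale real_basis =
  fixes S :: "'g::real_vector set"
  assumes finite_S: "finite S" and independent_S: "independent S" and span_S: "span S = UNIV"
begin

text \<open>A real basis \<open>S\<close> of the Lie algebra yields the complex basis of all
  \<open>(b, 0)\<close> of its complexification; these are the coordinates in that basis.\<close>

definition coord :: "'g \<Rightarrow> 'g cplx \<Rightarrow> complex" where
  "coord b z = Complex (representation S (fst z) b) (representation S (snd z) b)"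

lemma rep_simps:
  "representation S (u + v) b = representation S u b + representation S v b"
  "representation S (u - v) b = representation S u b - representation S v b"
  "representation S (r *\<^sub>R u) b = r * representation S u b"
  by (simp_all add: independent_S span_S real_vector.representation_add
      real_vector.representation_diff real_vector.representation_scale)

lemma rep_sum: "(\<Sum>b\<in>S. representation S v b *\<^sub>R b) = v"
  by (rule real_vector.sum_representation_eq) (auto simp: independent_S span_S finite_S)

lemma clinear_coord: "clinear_form (coord b)"
  by (auto simp: clinear_form_iff coord_def cscale_def rep_simps complex_eq_iff)

lemma coord_sum: "(\<Sum>b\<in>S. cscale (coord b z) (b, 0)) = z"
  by (rule prod_eqI) (simp_all add: fst_sum snd_sum cscale_def coord_def rep_sum)

lemma eq_0_if_coord: "(\<And>b. b \<in> S \<Longrightarrow> coord b z = 0) \<Longrightarrow> z = 0"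
  using coord_sum[of z] by simp

lemma coord_0 [simp]: "coord b 0 = 0"
  using clinear_coord[of b] unfolding clinear_form_iff by (metis cscale_simps(6) mult_zero_left)

lemma clinear_form_expand:
  assumes "clinear_form \<alpha>"
  shows "\<alpha> z = (\<Sum>b\<in>S. coord b z * \<alpha> (b, 0))"
proof -
  have a: "\<alpha> (x + y) = \<alpha> x + \<alpha> y" "\<alpha> (cscale c x) = c * \<alpha> x" for x y c
    using assms unfolding clinear_form_iff by blast+
  have "\<alpha> (\<Sum>b\<in>A. f b) = (\<Sum>b\<in>A. \<alpha> (f b))" for A and f :: "'g \<Rightarrow> _"
    using a(2)[of 0 0] by (induction A rule: infinite_finite_induct) (auto simp: a)
  from this[of "\<lambda>b. cscale (coord b z) (b, 0)" S] show ?thesis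
    by (simp add: coord_sum a)
qed

lemma clinear_map_expand:
  assumes "clinear_map L"
  shows "L z = (\<Sum>b\<in>S. cscale (coord b z) (L (b, 0)))"
proof -
  have a: "L (x + y) = L x + L y" "L (cscale c x) = cscale c (L x)" for x y c
    using assms unfolding clinear_map_iff by blast+
  have "L (\<Sum>b\<in>A. f b) = (\<Sum>b\<in>A. L (f b))" for A and f :: "'g \<Rightarrow> _"
    using a(2)[of 0 0] by (induction A rule: infinite_finite_induct) (auto simp: a)
  from this[of "\<lambda>b. cscale (coord b z) (b, 0)" S] show ?thesis
    by (simp add: coord_sum a)
qed

text \<open>Turns a condition on all vectors into finitely many equations, as needed for an analytic
  set.\<close>

lemma clinear_map_eq_0:
  assumes "clinear_map L" "\<And>b. b \<in> S \<Longrightarrow> L (b, 0) = 0"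
  shows "L z = 0"
  using clinear_map_expand[OF assms(1), of z] assms(2) by simp

text \<open>Bilinearity writes each component of the bracket as a finite sum of products of
  coordinates of \<open>F t\<close> and \<open>G t\<close> with constants.\<close>

lemma holo_vec_open_cbr:
  fixes br :: "'g \<Rightarrow> 'g \<Rightarrow> 'g"
  assumes add: "\<And>x x' y. cbr br (x + x') y = cbr br x y + cbr br x' y"
      "\<And>x y y'. cbr br x (y + y') = cbr br x y + cbr br x y'"
    and scale: "\<And>c x y. cbr br (cscale c x) y = cscale c (cbr br x y)"
      "\<And>c x y. cbr br x (cscale c y) = cscale c (cbr br x y)"
    and F: "holo_vec_open m U F" and G: "holo_vec_open m U G"
  shows "holo_vec_open m U (\<lambda>t. cbr br (F t) (G t))"
  unfolding holo_vec_open_def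
proof (intro allI impI)
  fix \<alpha> :: "'g cplx \<Rightarrow> complex"
  assume \<alpha>: "clinear_form \<alpha>"
  have "clinear_form (\<lambda>x. \<alpha> (cbr br x y))" "clinear_form (\<lambda>y. \<alpha> (cbr br x y))" for x y
    using \<alpha> unfolding clinear_form_iff
    by (simp_all add: add scale del: split_paired_All)
  then have "\<alpha> (cbr br x y) = (\<Sum>a\<in>S. coord a x * (\<Sum>b\<in>S. coord b y * \<alpha> (cbr br (a, 0) (b, 0))))" for x y
    by (subst clinear_form_expand, blast, subst (2) clinear_form_expand, blast) simp
  then have "(\<lambda>t. \<alpha> (cbr br (F t) (G t))) =
      (\<lambda>t. \<Sum>a\<in>S. coord a (F t) * (\<Sum>b\<in>S. coord b (G t) * \<alpha> (cbr br (a, 0) (b, 0))))"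
    by blast
  moreover have "holo_open m U (\<lambda>t. coord b (F t))" "holo_open m U (\<lambda>t. coord b (G t))" for b
    using F G clinear_coord unfolding holo_vec_open_def by blast+
  ultimately show "holo_open m U (\<lambda>t. \<alpha> (cbr br (F t) (G t)))"
    by (auto intro!: holo_open_sum holo_open_mult holo_open_const)
qed

text \<open>The vector \<open>t\<close> lists the matrix entries, in the order given by the
  enumeration \<open>k\<close> of \<open>S \<times> S\<close>.\<close>

definition mat_map :: "('g \<times> 'g \<Rightarrow> nat) \<Rightarrow> (nat \<Rightarrow> complex) \<Rightarrow> 'g cplx \<Rightarrow> 'g cplx" where
  "mat_map k t x = (\<Sum>b\<in>S. cscale (coord b x) (\<Sum>a\<in>S. cscale (t (k (a, b))) (a, 0)))"

lemma clinear_map_mat_map: "clinear_map (mat_map k t)"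
proof -
  have "cscale c (\<Sum>b\<in>A. f b) = (\<Sum>b\<in>A. cscale c (f b))" for A c and f :: "'g \<Rightarrow> 'g cplx"
    by (induction A rule: infinite_finite_induct) auto
  moreover have "coord b (x + y) = coord b x + coord b y" "coord b (cscale c x) = c * coord b x" for b x y c
    using clinear_coord[of b] unfolding clinear_form_iff by blast+
  ultimately show ?thesis
    unfolding clinear_map_iff mat_map_def
    by (simp add: cscale_left sum.distrib algebra_simps del: split_paired_All cscale_simps(1))
qed

lemma mat_map_origin: "mat_map k origin = (\<lambda>x. 0)"
  by (simp add: mat_map_def fun_eq_iff del: split_paired_All)

text \<open>A complex linear map is recovered exactly from its matrix, so the tautological family
  passes through every given endomorphism.\<close>

lemma mat_map_matrix:
  assumes "clinear_map L" "\<And>a b. a \<in> S \<Longrightarrow> b \<in> S \<Longrightarrow> t (k (a, b)) = coord a (L (b, 0))"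
  shows "mat_map k t = L"
proof
  fix x
  have "(\<Sum>a\<in>S. cscale (t (k (a, b))) (a, 0)) = L (b, 0)" if "b \<in> S" for b
    using assms(2) that coord_sum[of "L (b, 0)"] by simp
  then show "mat_map k t x = L x"
    unfolding mat_map_def using clinear_map_expand[OF assms(1), of x] by simp
qed

text \<open>The argument may vary with \<open>t\<close> as well, which covers nested terms such as
  \<open>\<Phi> (cbr br (\<Phi> y) x)\<close>.\<close>

lemma holo_vec_open_mat_map:
  assumes "holo_vec_open m U F"
  shows "holo_vec_open m U (\<lambda>t. mat_map k t (F t))"
  unfolding holo_vec_open_def
proof (intro allI impI)
  fix \<alpha> :: "'g cplx \<Rightarrow> complex"
  assume \<alpha>: "clinear_form \<alpha>"
  then have a: "\<alpha> (x + y) = \<alpha> x + \<alpha> y" "\<alpha> (cscale c x) = c * \<alpha> x" for x y c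
    unfolding clinear_form_iff by blast+
  have "\<alpha> (\<Sum>b\<in>A. f b) = (\<Sum>b\<in>A. \<alpha> (f b))" for A and f :: "'g \<Rightarrow> _"
    using a(2)[of 0 0] by (induction A rule: infinite_finite_induct) (auto simp: a)
  then have "\<alpha> (mat_map k t (F t)) = (\<Sum>b\<in>S. coord b (F t) * (\<Sum>a\<in>S. t (k (a, b)) * \<alpha> (a, 0)))" for t
    by (simp add: mat_map_def a)
  then show "holo_open m U (\<lambda>t. \<alpha> (mat_map k t (F t)))"
    using assms clinear_coord unfolding holo_vec_open_def
    by (auto intro!: holo_open_sum holo_open_mult holo_open_const holo_open_coordinate)
qed

section \<open>Small endomorphisms\<close>

text \<open>Finite dimension is known only through the basis \<open>S\<close>, so the theory of
  finite-dimensional spaces is instantiated with it.\<close>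

lemma linear_inj_imp_surj:
  fixes f :: "'g \<Rightarrow> 'g"
  assumes "linear f" "inj f"
  shows "surj f"
proof -
  interpret finite_dimensional_vector_space "scaleR :: real \<Rightarrow> 'g \<Rightarrow> 'g" S
    using finite_S independent_S span_S
    by unfold_locales (auto simp: dependent_raw_def span_raw_def)
  show ?thesis
    by (rule linear_inj_imp_surj) (use assms in \<open>auto simp: linear_def\<close>)
qed

text \<open>On real vectors, \<open>2 *\<^sub>R fst (\<Phi> (v, 0))\<close> is the value of \<open>\<Phi> + conj \<Phi>\<close>.\<close>

lemma bij_real_form_if_small:
  fixes e :: real
  assumes \<Phi>: "clinear_map \<Phi>"
    and small: "\<And>a b. a \<in> S \<Longrightarrow> b \<in> S \<Longrightarrow> cmod (coord a (\<Phi> (b, 0))) \<le> e" and e: "4 * card S * e \<le> 1"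
  shows "bij (\<lambda>v. v - 2 *\<^sub>R fst (\<Phi> (v, 0)))"
proof -
  let ?\<tau> = "\<lambda>v. v - 2 *\<^sub>R fst (\<Phi> (v, 0))"
  have \<Phi>_add: "\<Phi> (x + y) = \<Phi> x + \<Phi> y" and \<Phi>_scale: "\<Phi> (cscale c x) = cscale c (\<Phi> x)" for x y c
    using \<Phi> unfolding clinear_map_iff by blast+
  have "\<Phi> (x + y, 0) = \<Phi> (x, 0) + \<Phi> (y, 0)" "\<Phi> (r *\<^sub>R x, 0) = cscale (of_real r) (\<Phi> (x, 0))" for x y r
    using \<Phi>_add[of "(x, 0)" "(y, 0)"] \<Phi>_scale[of "of_real r" "(x, 0)"] by (simp_all add: cscale_def)
  then have "linear ?\<tau>"
    by (intro linearI) (simp_all add: cscale_def algebra_simps)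
  moreover have "inj ?\<tau>"
  proof (rule injI)
    fix x y
    assume eq: "x - 2 *\<^sub>R fst (\<Phi> (x, 0)) = y - 2 *\<^sub>R fst (\<Phi> (y, 0))"
    define v where "v = x - y"
    have "\<Phi> (x, 0) = \<Phi> (v, 0) + \<Phi> (y, 0)"
      using \<Phi>_add[of "(v, 0)" "(y, 0)"] by (simp add: v_def)
    then have v: "v = 2 *\<^sub>R fst (\<Phi> (v, 0))"
      using eq by (simp add: v_def algebra_simps)
    \<comment> \<open>\<open>N\<close> is the l1 norm of the kernel vector \<open>v\<close>. Since
      \<open>v\<close> is twice the real part of \<open>\<Phi> (v, 0)\<close>, each of its
      coordinates is at most \<open>2 * e * N\<close>. Summing over \<open>S\<close> gives
      \<open>N \<le> N / 2\<close>, hence \<open>N = 0\<close>.\<close>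
    define N where "N = (\<Sum>b\<in>S. \<bar>representation S v b\<bar>)"
    have bound: "\<bar>representation S v a\<bar> \<le> 2 * e * N" if "a \<in> S" for a
    proof -
      have cf: "clinear_form (\<lambda>z. coord a (\<Phi> z))"
        using \<Phi> clinear_coord[of a] unfolding clinear_form_iff clinear_map_iff by metis
      have cr: "coord b (v, 0) = of_real (representation S v b)" for b
        by (simp add: coord_def complex_eq_iff real_vector.representation_zero)
      have "representation S v a = 2 * Re (coord a (\<Phi> (v, 0)))"
        by (subst v) (simp add: coord_def rep_simps)
      then have "\<bar>representation S v a\<bar> \<le> 2 * cmod (coord a (\<Phi> (v, 0)))"
        using abs_Re_le_cmod[of "coord a (\<Phi> (v, 0))"] by simp
      also have "cmod (coord a (\<Phi> (v, 0))) = cmod (\<Sum>b\<in>S. coord b (v, 0) * coord a (\<Phi> (b, 0)))"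
        using clinear_form_expand[OF cf, of "(v, 0)"] by simp
      also have "\<dots> \<le> (\<Sum>b\<in>S. \<bar>representation S v b\<bar> * e)"
        by (rule sum_norm_le) (auto simp: cr norm_mult small that intro!: mult_left_mono)
      also have "\<dots> = e * N" by (simp add: N_def sum_distrib_left mult.commute)
      finally show ?thesis by simp
    qed
    have "N \<le> (\<Sum>b\<in>S. 2 * e * N)"
      unfolding N_def by (rule sum_mono) (use bound in \<open>simp add: N_def\<close>)
    then have "N \<le> 4 * card S * e * N / 2" by (simp add: algebra_simps)
    also have "\<dots> \<le> N / 2"
    proof -
      have "0 \<le> N" by (simp add: N_def sum_nonneg)
      from mult_right_mono[OF e this] show ?thesis by (simp add: mult_ac)
    qed
    finally have "N = 0" by (smt (verit) N_def sum_nonneg abs_ge_zero field_sum_of_halves)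
    then have "\<forall>b\<in>S. representation S v b = 0"
      unfolding N_def using finite_S by (simp add: sum_nonneg_eq_0_iff)
    then have "v = 0" using rep_sum[of v] by simp
    then show "x = y" by (simp add: v_def)
  qed
  ultimately show ?thesis using linear_inj_imp_surj by (simp add: bij_def)
qed

end

lemma real_basis_exists:
  fixes br :: "'g::real_vector \<Rightarrow> 'g \<Rightarrow> 'g"
  assumes "lie_algebra_with_cs br J"
  obtains S :: "'g set" where "real_basis S"
proof -
  obtain S :: "'g set" where S: "finite S" "span S = UNIV"
    using assms by (auto simp: lie_algebra_with_cs_def)
  obtain B where B: "B \<subseteq> S" "independent B" "S \<subseteq> span B"
    using maximal_independent_subset by blast
  have "span B = UNIV"
    using B(3) S(2) by (metis span_mono span_span top.extremum_uniqueI)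
  then have "real_basis B"
    using B(1,2) S(1) finite_subset by unfold_locales auto
  then show ?thesis by (rule that)
qed

section \<open>Integrability\<close>

text \<open>For \<open>(a, b)\<close> the eigenvector equation reads \<open>J a = b\<close> and
  \<open>J b = - a\<close>, and the second follows from the first. So the eigenspaces are the graphs
  of \<open>J\<close> and, in the next lemma, of \<open>- J\<close>.\<close>

lemma g01_eq: "linear J \<Longrightarrow> (\<And>x. J (J x) = - x) \<Longrightarrow> g01 J = range (\<lambda>x. (x, J x))"
  by (auto simp: g01_def cmap_def cscale_def image_iff)

lemma g10_eq: "linear J \<Longrightarrow> (\<And>x. J (J x) = - x) \<Longrightarrow> g10 J = range (\<lambda>x. (x, - J x))"
  by (auto simp: g10_def cmap_def cscale_def image_iff linear_neg)

text \<open>The bracket of two points of the graph of \<open>K\<close> lies on that graph again, so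
  its imaginary part is \<open>K\<close> of its real part. Applying \<open>K\<close> once more gives
  the Nijenhuis identity.\<close>

lemma integrable_if_g01_subalgebra:
  assumes br: "bilinear br" and K: "linear K" "\<And>x. K (K x) = - x"
    and sub: "\<And>z w. z \<in> g01 K \<Longrightarrow> w \<in> g01 K \<Longrightarrow> cbr br z w \<in> g01 K"
  shows "br (K x) (K y) - br x y - K (br (K x) y) - K (br x (K y)) = 0"
proof -
  have "cbr br (x, K x) (y, K y) \<in> g01 K"
    by (rule sub) (auto simp: g01_eq[OF K])
  then have "br x (K y) + br (K x) y = K (br x y - br (K x) (K y))"
    by (auto simp: g01_eq[OF K] cbr_def)
  then have "K (br x (K y) + br (K x) y) = - (br x y - br (K x) (K y))"
    by (simp only: K(2))
  then show ?thesis by (simp add: linear_add[OF K(1)] algebra_simps)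
qed

context
  fixes br :: "'g::real_vector \<Rightarrow> 'g \<Rightarrow> 'g" and J :: "'g \<Rightarrow> 'g"
  assumes cs: "lie_algebra_with_cs br J"
begin

text \<open>Replacing \<open>J\<close> by \<open>- J\<close> swaps the two eigenspaces, which
  reduces the claim to \<open>cbr_g10\<close>.\<close>

lemma cbr_g01:
  assumes "x \<in> g01 J" "y \<in> g01 J"
  shows "cbr br x y \<in> g01 J"
proof -
  have "linear (\<lambda>x. - J x)" using J_linear[OF cs] by (rule linear_compose_neg)
  then have "lie_algebra_with_cs br (\<lambda>x. - J x)"
    using cs unfolding lie_algebra_with_cs_def complex_structure_def
    by (auto simp: linear_neg[OF J_linear[OF cs]] br_simps[OF cs])
  moreover have "g10 (\<lambda>x. - J x) = g01 J"
    by (auto simp: g10_def g01_def cmap_def cscale_def) (metis add.inverse_inverse)+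
  ultimately show ?thesis using assms cbr_g10 by metis
qed

lemma cbr_skew: "cbr br x y = - cbr br y x"
  using br_skew[OF cs, of "fst x" "fst y"] br_skew[OF cs, of "snd x" "snd y"]
    br_skew[OF cs, of "fst x" "snd y"] br_skew[OF cs, of "snd x" "fst y"]
  by (simp add: cbr_def)

text \<open>For equal arguments the terms of the bracket coincide in pairs, by skew-symmetry of
  \<open>cbr br\<close>, and the resulting factor 2 cancels the 1/2. The right-hand side is visibly
  polynomial in the entries of \<open>\<Phi>\<close>.\<close>

lemma integrability_equation_iff:
  assumes "\<Phi> \<in> Lam01_g10 J"
  shows "dbar br J \<Phi> = (\<lambda>x y. cscale (1/2) (fn_bracket br J \<Phi> \<Phi> x y)) \<longleftrightarrow>
    (\<forall>x y. pr10 J (cbr br (pr01 J x) (\<Phi> y)) - pr10 J (cbr br (pr01 J y) (\<Phi> x))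
       - \<Phi> (cbr br (pr01 J x) (pr01 J y)) =
     cbr br (\<Phi> x) (\<Phi> y) + \<Phi> (cbr br (\<Phi> y) x) - \<Phi> (cbr br (\<Phi> x) y))"
proof -
  have double: "cscale 2 z = z + z" for z :: "'g cplx"
    using cscale_left(1)[of 1 1 z] by simp
  have "fn_bracket br J \<Phi> \<Phi> x y =
      cscale 2 (cbr br (\<Phi> x) (\<Phi> y) + \<Phi> (cbr br (\<Phi> y) x) - \<Phi> (cbr br (\<Phi> x) y))" for x y
    using cbr_skew[of "\<Phi> y" "\<Phi> x"]
    by (simp add: double is_fn_bracket_apply[OF cs is_fn_bracket_fn_bracket[OF cs] assms assms])
  then show ?thesis
    by (simp add: fun_eq_iff is_dbar_apply[OF cs is_dbar_dbar[OF cs] assms] del: split_paired_All)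
qed

text \<open>A vector lies in the image of \<open>g01 J\<close> under \<open>1 - \<Phi>\<close>
  exactly when its (1,0)-part is \<open>- \<Phi>\<close> of its (0,1)-part. For the bracket on the
  left, the integrability equation is this very relation.\<close>

lemma integrability_imp_subalgebra:
  assumes \<Phi>: "\<Phi> \<in> Lam01_g10 J"
    and MC: "dbar br J \<Phi> = (\<lambda>x y. cscale (1/2) (fn_bracket br J \<Phi> \<Phi> x y))"
    and x: "x \<in> g01 J" and y: "y \<in> g01 J"
  shows "cbr br (x - \<Phi> x) (y - \<Phi> y) \<in> (\<lambda>x. x - \<Phi> x) ` g01 J"
proof -
  have pr01_g01: "pr01 J z = z" and pr10_g01: "pr10 J z = 0" if "z \<in> g01 J" for z
    using that by (simp_all add: g01_def pr01_def pr10_def cscale_left cscale_half_double)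
  have split: "pr10 J z = z - pr01 J z" for z
    using pr_sum[OF cs, of z] by (simp add: algebra_simps)
  note V = V_add[OF cs \<Phi>] V_neg[OF cs \<Phi>] V_pr01[OF cs \<Phi>]
  have V_diff: "\<Phi> (u - v) = \<Phi> u - \<Phi> v" for u v
    using V(1)[of u "- v"] by (simp add: V(2))
  \<comment> \<open>The only possible preimage: \<open>\<Phi>\<close> has values in
    \<open>g10 J\<close>, so the (0,1)-part of \<open>w - \<Phi> w\<close> is \<open>w\<close> for
    \<open>w\<close> in \<open>g01 J\<close>.\<close>
  define z where "z = pr01 J (cbr br (x - \<Phi> x) (y - \<Phi> y))"
  have cbr_diff: "cbr br (a - b) (c - d) = cbr br a c - cbr br a d - cbr br b c + cbr br b d" for a b c d
    using cbr_add(1)[OF cs, of a "- b"] cbr_add(2)[OF cs, of _ c "- d"]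
    by (simp add: cbr_minus[OF cs])
  have pr01_diff: "pr01 J (a - b) = pr01 J a - pr01 J b" and pr01_add: "pr01 J (a + b) = pr01 J a + pr01 J b" for a b
    by (simp_all add: pr01_def cmapJ[OF cs])
  have \<Phi>\<Phi>: "pr01 J (cbr br (\<Phi> x) (\<Phi> y)) = 0"
    by (intro pr01_on[OF cs] cbr_g10[OF cs] V_in[OF cs \<Phi>])
  have "pr10 J (cbr br x (\<Phi> y)) - pr10 J (cbr br y (\<Phi> x)) - \<Phi> (cbr br x y) =
      cbr br (\<Phi> x) (\<Phi> y) + \<Phi> (cbr br (\<Phi> y) x) - \<Phi> (cbr br (\<Phi> x) y)"
    using MC unfolding integrability_equation_iff[OF \<Phi>] by (metis pr01_g01 x y)
  then have MC': "cbr br (\<Phi> x) (\<Phi> y) = pr10 J (cbr br x (\<Phi> y)) + pr10 J (cbr br (\<Phi> x) y)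
      - \<Phi> (cbr br x y) + \<Phi> (cbr br x (\<Phi> y)) + \<Phi> (cbr br (\<Phi> x) y)"
    using cbr_skew[of y "\<Phi> x"] cbr_skew[of "\<Phi> y" x] by (simp add: V pr_lin[OF cs] algebra_simps)
  have z: "z = cbr br x y - pr01 J (cbr br x (\<Phi> y)) - pr01 J (cbr br (\<Phi> x) y)"
    unfolding z_def cbr_diff by (simp add: pr01_diff pr01_add \<Phi>\<Phi> pr01_g01 cbr_g01 x y)
  have "cbr br (x - \<Phi> x) (y - \<Phi> y) = z - \<Phi> z"
    unfolding cbr_diff MC' z by (simp add: V_diff V split algebra_simps)
  moreover have "z \<in> g01 J" by (simp add: z_def pr01_in[OF cs])
  ultimately show ?thesis by blast
qed

lemma induced_cs_exists:
  assumes \<Phi>: "\<Phi> \<in> Lam01_g10 J"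
    and MC: "dbar br J \<Phi> = (\<lambda>x y. cscale (1/2) (fn_bracket br J \<Phi> \<Phi> x y))"
    and bij: "bij (\<lambda>v. v - 2 *\<^sub>R fst (\<Phi> (v, 0)))"
  shows "\<exists>K. induced_cs br J \<Phi> K"
proof -
  define \<tau> where "\<tau> v = v - 2 *\<^sub>R fst (\<Phi> (v, 0))" for v
  have V: "\<Phi> (x + y) = \<Phi> x + \<Phi> y" "\<Phi> (cscale c x) = cscale c (\<Phi> x)" for x y c
    by (rule V_add[OF cs \<Phi>] V_scale[OF cs \<Phi>])+
  have \<Phi>_pair: "\<Phi> (a, b) = \<Phi> (a, 0) + cscale \<i> (\<Phi> (b, 0))" for a b
    using V(1)[of "(a, 0)" "(0, b)"] V(2)[of \<i> "(b, 0)"] by (simp add: cscale_def)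
  have \<Phi>_real: "\<Phi> (a + b, 0) = \<Phi> (a, 0) + \<Phi> (b, 0)" "\<Phi> (r *\<^sub>R a, 0) = cscale (of_real r) (\<Phi> (a, 0))" for a b r
    using V(1)[of "(a, 0)" "(b, 0)"] V(2)[of "of_real r" "(a, 0)"] by (simp_all add: cscale_def)
  have lin: "linear \<tau>"
    by (rule linearI) (simp_all add: \<tau>_def \<Phi>_real cscale_def algebra_simps)
  have bij\<tau>: "bij \<tau>" using bij unfolding \<tau>_def .
  have inv: "\<tau> (inv \<tau> v) = v" "inv \<tau> (\<tau> v) = v" for v
    using bij\<tau> by (simp_all add: bij_is_surj surj_f_inv_f bij_is_inj)
  have lin_inv: "linear (inv \<tau>)"
  proof (rule linearI)
    show "inv \<tau> (x + y) = inv \<tau> x + inv \<tau> y" for x y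
      by (metis inv linear_add[OF lin])
    show "inv \<tau> (r *\<^sub>R x) = r *\<^sub>R inv \<tau> x" for r x
      by (metis inv linear_scale[OF lin])
  qed
  \<comment> \<open>\<open>\<Phi>\<close> vanishes on \<open>g10 J\<close> and
    \<open>conj_map \<Phi>\<close> on \<open>g01 J\<close>. Hence the complexified
    \<open>\<tau>\<close> restricts to each eigenspace of \<open>J\<close> as the map prescribed in
    \<open>induced_cs\<close>.\<close>
  have cmap_\<tau>: "cmap \<tau> z = z - \<Phi> z - conj_map \<Phi> z" for z
  proof -
    obtain a b where z: "z = (a, b)" by force
    have "\<Phi> (- b, 0) = - \<Phi> (b, 0)"
      using \<Phi>_real(2)[of "-1" b] by (simp add: cscale_left)
    then show ?thesis
      unfolding z conj_map_def conj_cplx_def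
      by (simp add: \<Phi>_pair[of a b] \<Phi>_pair[of a "- b"] cmap_def \<tau>_def cscale_def prod_eq_iff scaleR_2)
  qed
  have conj_g: "conj_cplx z \<in> g10 J" if "z \<in> g01 J" for z
    using that
    by (auto simp: g01_def g10_def conj_cplx_def cmap_def cscale_def linear_neg[OF J_linear[OF cs]])
  have \<tau>_g01: "cmap \<tau> z = z - \<Phi> z" if "z \<in> g01 J" for z
    using V_0[OF cs \<Phi> conj_g[OF that]] by (simp add: cmap_\<tau> conj_map_def conj_cplx_def zero_prod_def)
  have \<tau>_g10: "cmap \<tau> z = z - conj_map \<Phi> z" if "z \<in> g10 J" for z
    using that V_0[OF cs \<Phi>, of z] by (simp add: cmap_\<tau>)
  define K where "K = \<tau> \<circ> J \<circ> inv \<tau>"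
  have K: "linear K" "K (K x) = - x" for x
    unfolding K_def using J_sq[OF cs]
    by (auto simp: inv linear_neg[OF lin] intro: linear_compose lin lin_inv J_linear[OF cs])
  have K\<tau>: "K (\<tau> x) = \<tau> (J x)" for x by (simp add: K_def inv)
  \<comment> \<open>Reparametrising by the bijection \<open>\<tau>\<close> exhibits the graphs of
    \<open>K\<close> and \<open>- K\<close> as images of those of \<open>J\<close> and
    \<open>- J\<close>.\<close>
  have range: "range f = range (\<lambda>x. f (\<tau> x))" for f :: "'g \<Rightarrow> 'g \<times> 'g"
    using bij\<tau> by (metis bij_is_surj fun.set_map image_image)
  note J = J_linear[OF cs] J_sq[OF cs]
  have g01K: "g01 K = cmap \<tau> ` g01 J"
    unfolding g01_eq[OF K] g01_eq[OF J] by (subst range) (simp add: K\<tau> image_image cmap_def)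
  have g10K: "g10 K = cmap \<tau> ` g10 J"
    unfolding g10_eq[OF K] g10_eq[OF J]
    by (subst range) (simp add: K\<tau> image_image cmap_def linear_neg[OF lin])
  have g01K': "g01 K = (\<lambda>x. x - \<Phi> x) ` g01 J"
    unfolding g01K by (rule image_cong) (simp_all add: \<tau>_g01)
  have "cbr br z w \<in> g01 K" if "z \<in> g01 K" "w \<in> g01 K" for z w
    using that unfolding g01K' by (auto intro: integrability_imp_subalgebra[OF \<Phi> MC])
  then have "complex_structure br K"
    using K integrable_if_g01_subalgebra[OF br_bilinear[OF cs] K] by (simp add: complex_structure_def)
  moreover have "g10 K = (\<lambda>x. x - conj_map \<Phi> x) ` g10 J"
    unfolding g10K by (rule image_cong) (simp_all add: \<tau>_g10)
  ultimately show ?thesis using g01K' unfolding induced_cs_def by blast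
qed

end

section \<open>The tautological family\<close>

text \<open>The equations are global, so the polydisc itself serves as the neighbourhood of every
  point.\<close>

lemma analytic_subset_vanishing:
  assumes "finite F" "\<And>f. f \<in> F \<Longrightarrow> holo_open m (polydisc m) f"
  shows "analytic_subset m {t \<in> polydisc m. \<forall>f\<in>F. f t = 0}"
  unfolding analytic_subset_def using assms open_Cn_polydisc[of m]
  by (intro conjI ballI exI[of _ "polydisc m"] exI[of _ F]) auto

lemma (in real_basis) analytic_subset_vec_vanishing:
  fixes F :: "((nat \<Rightarrow> complex) \<Rightarrow> 'g cplx) set"
  assumes "finite F" "\<And>f. f \<in> F \<Longrightarrow> holo_vec_open m (polydisc m) f"
  shows "analytic_subset m {t \<in> polydisc m. \<forall>f\<in>F. f t = 0}"
proof -
  let ?G = "(\<lambda>(b, f) t. coord b (f t)) ` (S \<times> F)"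
  have "analytic_subset m {t \<in> polydisc m. \<forall>g\<in>?G. g t = 0}"
    using assms finite_S clinear_coord unfolding holo_vec_open_def
    by (intro analytic_subset_vanishing) auto
  moreover have "(\<forall>g\<in>?G. g t = 0) \<longleftrightarrow> (\<forall>f\<in>F. f t = 0)" for t
  proof
    assume "\<forall>g\<in>?G. g t = 0"
    then have "coord b (f t) = 0" if "f \<in> F" "b \<in> S" for f b
      using that by auto
    then show "\<forall>f\<in>F. f t = 0" using eq_0_if_coord by blast
  qed auto
  ultimately show ?thesis by simp
qed

text \<open>Being in \<open>Lam01_g10 J\<close> is linear in the entries and the integrability
  equation is quadratic. Both can be tested on basis vectors, which leaves finitely many holomorphic
  equations.\<close>

lemma (in real_basis) analytic_subset_integrable:
  fixes br :: "'g \<Rightarrow> 'g \<Rightarrow> 'g"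
  assumes cs: "lie_algebra_with_cs br J"
  shows "analytic_subset m {t \<in> polydisc m. mat_map k t \<in> Lam01_g10 J \<and>
    dbar br J (mat_map k t) = (\<lambda>x y. cscale (1/2) (fn_bracket br J (mat_map k t) (mat_map k t) x y))}"
proof -
  \<comment> \<open>The defect of the integrability equation in the explicit form of
    \<open>integrability_equation_iff\<close>.\<close>
  define E where "E x y t =
      pr10 J (cbr br (pr01 J x) (mat_map k t y)) - pr10 J (cbr br (pr01 J y) (mat_map k t x))
       - mat_map k t (cbr br (pr01 J x) (pr01 J y)) -
     (cbr br (mat_map k t x) (mat_map k t y) + mat_map k t (cbr br (mat_map k t y) x)
       - mat_map k t (cbr br (mat_map k t x) y))" for x y t
  \<comment> \<open>The three families express vanishing on \<open>g10 J\<close>, values in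
    \<open>g10 J\<close>, and vanishing of the defect.\<close>
  define F where "F = (\<lambda>b t. mat_map k t (pr10 J (b, 0))) ` S
    \<union> (\<lambda>b t. pr01 J (mat_map k t (b, 0))) ` S
    \<union> (\<lambda>(a, b). E (a, 0) (b, 0)) ` (S \<times> S)"
  note lin = clinear_map_mat_map[unfolded clinear_map_iff]
  have M: "mat_map k t (x + y) = mat_map k t x + mat_map k t y"
    "mat_map k t (cscale c x) = cscale c (mat_map k t x)" for t x y c
    using lin by blast+
  have pr: "clinear_map (pr10 J)" "clinear_map (pr01 J)"
    by (simp_all add: clinear_map_iff pr_lin[OF cs] del: split_paired_All)
  note cbr_lin = cbr_add[OF cs] cbr_scale[OF cs]
  have holo: "holo_vec_open m U (\<lambda>t. mat_map k t x)" for U x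
    by (rule holo_vec_open_mat_map holo_vec_open_const)+
  have "holo_vec_open m U (E x y)" for U x y
    unfolding E_def
    by (intro holo_vec_open_add holo_vec_open_diff holo_vec_open_mat_map holo_vec_open_const
        holo_vec_open_clinear[OF pr(1)] holo_vec_open_cbr cbr_lin)
  then have "f \<in> F \<Longrightarrow> holo_vec_open m (polydisc m) f" for f
    unfolding F_def by (auto intro!: holo holo_vec_open_clinear[OF pr(2)])
  moreover have "finite F" unfolding F_def using finite_S by simp
  moreover have "(mat_map k t \<in> Lam01_g10 J \<and>
      dbar br J (mat_map k t) = (\<lambda>x y. cscale (1/2) (fn_bracket br J (mat_map k t) (mat_map k t) x y)))
    \<longleftrightarrow> (\<forall>f\<in>F. f t = 0)" (is "?L \<longleftrightarrow> ?R") for t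
  proof
    assume ?L
    then have L: "mat_map k t \<in> Lam01_g10 J" and MC: "E x y t = 0" for x y
      by (auto simp: E_def integrability_equation_iff[OF cs] simp del: split_paired_All)
    show ?R
      unfolding F_def
      by (auto simp: V_0[OF cs L] V_in[OF cs L] pr10_in[OF cs] pr01_on[OF cs] MC)
  next
    assume R: ?R
    have "mat_map k t (pr10 J x) = 0" for x
      by (rule clinear_map_eq_0[of "\<lambda>x. mat_map k t (pr10 J x)"])
        (use R in \<open>auto simp: F_def clinear_map_iff pr_lin[OF cs] M simp del: split_paired_All\<close>)
    moreover have "pr01 J (mat_map k t x) = 0" for x
      by (rule clinear_map_eq_0[of "\<lambda>x. pr01 J (mat_map k t x)"])
        (use R in \<open>auto simp: F_def clinear_map_iff pr_lin[OF cs] M simp del: split_paired_All\<close>)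
    ultimately have "mat_map k t x \<in> g10 J" "x \<in> g10 J \<Longrightarrow> mat_map k t x = 0" for x
      using pr_sum[OF cs, of "mat_map k t x"] pr10_in[OF cs, of "mat_map k t x"] pr10_on[OF cs, of x]
      by (metis add.right_neutral)+
    then have L: "mat_map k t \<in> Lam01_g10 J"
      unfolding Lam01_g10_def using clinear_map_mat_map by blast
    \<comment> \<open>The defect is complex bilinear in \<open>x\<close> and \<open>y\<close>, so
      its vanishing on pairs of basis vectors extends to all pairs in two steps.\<close>
    have E_lin: "clinear_map (\<lambda>x. E x y t)" "clinear_map (\<lambda>y. E x y t)" for x y
      unfolding E_def clinear_map_iff
      by (simp_all add: pr_lin[OF cs] M cbr_lin algebra_simps del: split_paired_All)
    have "E (a, 0) y t = 0" if "a \<in> S" for a y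
      by (rule clinear_map_eq_0[OF E_lin(2)]) (use R that in \<open>auto simp: F_def\<close>)
    then have "E x y t = 0" for x y
      by (rule clinear_map_eq_0[OF E_lin(1)])
    then show ?L
      using L by (simp add: E_def integrability_equation_iff[OF cs] del: split_paired_All)
  qed
  ultimately show ?thesis using analytic_subset_vec_vanishing[of F m] by simp
qed

section \<open>The base of the tautological family and the classifying map of a given
  deformation\<close>

theorem theorem1p1:
  fixes br :: "'g::real_vector \<Rightarrow> 'g \<Rightarrow> 'g" and J :: "'g \<Rightarrow> 'g"
  assumes "lie_algebra_with_cs br J"
  shows "\<exists>m B \<phi>. complete_deformation br J m B \<phi>"
proof -
  note cs = assms
  obtain S :: "'g set" where "real_basis S" using real_basis_exists[OF cs] .
  then interpret real_basis S .
  define m where "m = card (S \<times> S)"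
  obtain k where k: "bij_betw k (S \<times> S) {..<m}"
    using ex_bij_betw_finite_nat[of "S \<times> S"] finite_S by (auto simp: m_def lessThan_atLeast0)
  \<comment> \<open>Entries are bounded by 1 only. The sharper bound that makes the induced complex
    structure exist is imposed later, by shrinking the source of the classifying map.\<close>
  define B where "B = {t \<in> polydisc m. mat_map k t \<in> Lam01_g10 J \<and>
    dbar br J (mat_map k t) = (\<lambda>x y. cscale (1/2) (fn_bracket br J (mat_map k t) (mat_map k t) x y))}"
  have B: "analytic_subset m B"
    unfolding B_def by (rule analytic_subset_integrable[OF cs])
  have "holo_vec_on m B (\<lambda>t. mat_map k t x)" for x
    unfolding holo_vec_on_def
  proof (intro allI impI)
    fix \<alpha> :: "'g cplx \<Rightarrow> complex"
    assume "clinear_form \<alpha>"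
    then have "holo_open m (polydisc m) (\<lambda>t. \<alpha> (mat_map k t x))"
      using holo_vec_open_mat_map[OF holo_vec_open_const] unfolding holo_vec_open_def by blast
    then show "holo_on m B (\<lambda>t. \<alpha> (mat_map k t x))"
      using open_Cn_polydisc by (rule_tac holo_on_if_holo_open) (auto simp: B_def)
  qed
  moreover have origin_B: "origin \<in> B"
    unfolding B_def
    by (auto simp: mat_map_origin integrability_equation_iff[OF cs] V_closed[OF cs] polydisc_def Cn_def
        cbr_zero[OF cs] pr_lin(2)[OF cs, of 0 0, simplified])
  ultimately have def: "holomorphic_deformation br J m B (mat_map k)"
    using B unfolding holomorphic_deformation_def by (auto simp: B_def mat_map_origin)
  have "\<exists>W h. open_Cn l W \<and> origin \<in> W \<and> holo_map_on l (D \<inter> W) m B h \<and> h origin = origin \<and>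
      equivalent_over br J l (D \<inter> W) \<psi> (\<lambda>s. mat_map k (h s))"
    if \<psi>: "holomorphic_deformation br J l D \<psi>" for l D \<psi>
  proof -
    have D: "D \<subseteq> Cn l" "origin \<in> D"
      and \<psi>_in: "\<And>s. s \<in> D \<Longrightarrow> \<psi> s \<in> Lam01_g10 J" and \<psi>_holo: "\<And>x. holo_vec_on l D (\<lambda>s. \<psi> s x)"
      and \<psi>_0: "\<psi> origin = (\<lambda>x. 0)"
      and MC: "\<And>s. s \<in> D \<Longrightarrow> dbar br J (\<psi> s) = (\<lambda>x y. cscale (1/2) (fn_bracket br J (\<psi> s) (\<psi> s) x y))"
      using \<psi> unfolding holomorphic_deformation_def analytic_subset_def polydisc_def by blast+
    define entry where "entry s = (\<lambda>(a, b). coord a (\<psi> s (b, 0)))" for s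
    \<comment> \<open>The value 0 from index \<open>m\<close> on places \<open>h s\<close> in
      \<open>Cn m\<close>.\<close>
    define h where "h s i = (if i < m then entry s (inv_into (S \<times> S) k i) else 0)" for s i
    have h_k: "h s (k p) = entry s p" if "p \<in> S \<times> S" for s p
      using k that bij_betw_apply[OF k that] by (simp add: h_def bij_betw_inv_into_left)
    have entry_holo: "holo_on l D (\<lambda>s. entry s p)" for p
      using \<psi>_holo clinear_coord unfolding entry_def holo_vec_on_def by (simp add: split_def)
    have h_holo: "holo_on l D (\<lambda>s. h s i)" if "i < m" for i
      using entry_holo that by (simp add: h_def)
    \<comment> \<open>Chosen to meet the bound of \<open>bij_real_form_if_small\<close>. The summand
      4 keeps \<open>e\<close> below 1, so that \<open>h s\<close> stays in the polydisc, and the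
      denominator nonzero even when \<open>S\<close> is empty.\<close>
    define e :: real where "e = 1 / (4 * card S + 4)"
    have e: "0 < e" "e < 1" "4 * card S * e \<le> 1" by (simp_all add: e_def field_simps)
    have h_0: "h origin = origin"
      by (simp add: h_def entry_def \<psi>_0 split_def fun_eq_iff)
    obtain W where W: "open_Cn l W" "origin \<in> W" "\<forall>s\<in>D \<inter> W. \<forall>i\<in>{..<m}. cmod (h s i) < e"
      using holo_on_small_nbhd_finite[of "{..<m}" l D "\<lambda>i s. h s i" origin e] h_holo D e(1) h_0
      by auto
    have mat: "mat_map k (h s) = \<psi> s" if "s \<in> D" for s
      using \<psi>_in[OF that] h_k by (intro mat_map_matrix) (auto simp: Lam01_g10_def entry_def)
    have h_in: "h s \<in> B" if "s \<in> D \<inter> W" for s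
    proof -
      have "h s \<in> polydisc m"
        using W(3) that e(2) by (force simp: polydisc_def Cn_def h_def)
      then show ?thesis using that mat \<psi>_in MC by (auto simp: B_def)
    qed
    have "\<exists>K. induced_cs br J (\<psi> s) K" if s: "s \<in> D \<inter> W" for s
    proof -
      have \<Psi>: "\<psi> s \<in> Lam01_g10 J" using \<psi>_in s by blast
      have "cmod (coord a (\<psi> s (b, 0))) \<le> e" if "a \<in> S" "b \<in> S" for a b
      proof -
        have "k (a, b) \<in> {..<m}" using bij_betw_apply[OF k] that by blast
        then have "cmod (h s (k (a, b))) < e" using W(3) s by blast
        then show ?thesis using h_k[of "(a, b)" s] that by (simp add: entry_def)
      qed
      then have "bij (\<lambda>v. v - 2 *\<^sub>R fst (\<psi> s (v, 0)))"
        using \<Psi> e(3) by (intro bij_real_form_if_small) (auto simp: Lam01_g10_def)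
      then show ?thesis using induced_cs_exists[OF cs \<Psi>] MC s by blast
    qed
    \<comment> \<open>By \<open>mat\<close> the pullback equals \<open>\<psi>\<close> on
      \<open>D\<close>, so the constant family \<open>id\<close> is an equivalence once the induced
      structure exists; it serves as both \<open>K\<close> and \<open>K'\<close>.\<close>
    then have "equivalent_over br J l (D \<inter> W) \<psi> (\<lambda>s. mat_map k (h s))"
      unfolding equivalent_over_def using D(1) mat
      by (intro exI[of _ "\<lambda>_. id"])
        (auto simp: lie_automorphism_def linear_id cmap_def holo_vec_on_def intro!: holo_on_const)
    moreover have "holo_map_on l (D \<inter> W) m B h"
      unfolding holo_map_on_def using h_in h_holo holo_on_subset by blast
    ultimately show ?thesis using W h_0 by blast
  qed
  then show ?thesis using def unfolding complete_deformation_def by blast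
qed

end
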